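(* Let $n\ge 1$, let $\Bbbk$ be a field of characteristic $p>0$, and let $R$ be a $\Bbbk$-subalgebra of the polynomial ring $\Bbbk[X]=\Bbbk[x_1,\dots,x_n]$. Let $J(R)$ be the Jacobian ideal of $R$ (an ideal of $\Bbbk[X]$). If $J(R)$ is a principal ideal of $\Bbbk[X]$, then $$J(R)^{q}\subset R[X^p],$$ where $R[X^p]=R[x_1^p,\dots,x_n^p]$ and $q=\frac{p^n(p-1)}{2}$.
   Context: Jacobian ideal: for a $\Bbbk$-subalgebra $R$ of $\Bbbk[X]=\Bbbk[x_1,\dots,x_n]$, $J(R)$ is the ideal of $\Bbbk[X]$ defined by $J(R)\,\Omega^n_{\Bbbk[X]/\Bbbk}=\Bbbk[X]\,\Omega^n_{R/\Bbbk}$, where the right-hand side denotes the $\Bbbk[X]$-submodule of $\Omega^n_{\Bbbk[X]/\Bbbk}$ generated by the image of the natural map $\Omega^n_{R/\Bbbk}\to\Omega^n_{\Bbbk[X]/\Bbbk}$. Equivalently, $J(R)$ is the ideal of $\Bbbk[X]$ generated by all Jacobians $j(F)=\det\left(\frac{\partial f_i}{\partial x_j}\right)_{1\le i,j\le n}$ with $F=(f_1,\dots,f_n)\in R^n$. $R[x_1^p,\dots,x_n^p]$ is the subalgebra of $\Bbbk[X]$ generated by $R$ and $x_1^p,\dots,x_n^p$. $J(R)^q$ is the $q$-th power of the ideal $J(R)$. *)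

theory Defs
  imports "HOL-Library.Poly_Mapping" "HOL-Analysis.Determinants"
begin

section \<open>Multivariate polynomials\<close>

text \<open>Polynomials in variables indexed by the type \<open>'n\<close>: finitely supported functions from
  exponent vectors to coefficients, with the convolution product of Poly_Mapping.\<close>

type_synonym ('n, 'k) mpoly = "('n \<Rightarrow>\<^sub>0 nat) \<Rightarrow>\<^sub>0 'k"

definition Const :: "'k::zero \<Rightarrow> ('n, 'k) mpoly" where
  "Const c = Poly_Mapping.single 0 c"

definition Var :: "'n \<Rightarrow> ('n, 'k::zero_neq_one) mpoly" where
  "Var i = Poly_Mapping.single (Poly_Mapping.single i 1) 1"

definition subalgebra :: "('n, 'k::comm_ring_1) mpoly set \<Rightarrow> bool" where
  "subalgebra R \<longleftrightarrow>
     range Const \<subseteq> R \<and> (\<forall>f\<in>R. \<forall>g\<in>R. f + g \<in> R) \<and> (\<forall>f\<in>R. \<forall>g\<in>R. f * g \<in> R)"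

definition adjoin :: "('n, 'k::comm_ring_1) mpoly set \<Rightarrow> ('n, 'k) mpoly set \<Rightarrow> ('n, 'k) mpoly set" where
  "adjoin R S = subalgebra hull (R \<union> S)"


section \<open>Ideals\<close>

text \<open>Ideals are the submodules of a ring regarded as a module over itself.\<close>

lemma module_times: "module ((*) :: 'a::comm_ring_1 \<Rightarrow> 'a \<Rightarrow> 'a)"
  by unfold_locales (simp_all add: algebra_simps)

definition is_ideal :: "'a::comm_ring_1 set \<Rightarrow> bool" where
  "is_ideal I \<longleftrightarrow> module.subspace (*) I"

definition ideal_gen :: "'a::comm_ring_1 set \<Rightarrow> 'a set" where
  "ideal_gen S = module.span (*) S"

definition principal_ideal :: "'a::comm_ring_1 set \<Rightarrow> bool" where
  "principal_ideal I \<longleftrightarrow> (\<exists>d. I = ideal_gen {d})"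

primrec ideal_power :: "'a::comm_ring_1 set \<Rightarrow> nat \<Rightarrow> 'a set" where
  "ideal_power I 0 = UNIV"
| "ideal_power I (Suc m) = ideal_gen {a * b | a b. a \<in> I \<and> b \<in> ideal_power I m}"


section \<open>Differential forms of top degree\<close>

text \<open>
  For subrings \<open>K \<subseteq> A\<close> of a commutative ring and a finite index type \<open>'n\<close> with \<open>n\<close> elements,
  the \<open>A\<close>-module of Kaehler \<open>n\<close>-forms of \<open>A\<close> over \<open>K\<close> is presented by the symbols
  \<open>da\<^sub>1 \<and> \<dots> \<and> da\<^sub>n\<close> with all \<open>a\<^sub>i\<close> in \<open>A\<close>.  The relations are: in every slot \<open>d\<close> is additive,
  satisfies the Leibniz rule and kills \<open>K\<close>; and a symbol with a repeated entry is zero.  This is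
  the \<open>n\<close>-th exterior power over \<open>A\<close> of the module of Kaehler differentials, as \<open>A\<close>-linear maps
  out of it are the same as alternating \<open>A\<close>-multilinear maps on the latter.  Slots are
  indexed by \<open>'n\<close>, so a symbol is a function \<open>'n \<Rightarrow> 'a\<close>.
\<close>

definition fscale :: "'a::comm_ring_1 \<Rightarrow> ('s \<Rightarrow>\<^sub>0 'a) \<Rightarrow> ('s \<Rightarrow>\<^sub>0 'a)" where
  "fscale c w = Poly_Mapping.map ((*) c) w"

definition symb :: "('n \<Rightarrow> 'a::comm_ring_1) \<Rightarrow> (('n \<Rightarrow> 'a) \<Rightarrow>\<^sub>0 'a)" where
  "symb f = Poly_Mapping.single f 1"

inductive_set lincomb :: "'a::comm_ring_1 set \<Rightarrow> ('s \<Rightarrow>\<^sub>0 'a) set \<Rightarrow> ('s \<Rightarrow>\<^sub>0 'a) set"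
  for A S where
  zero: "0 \<in> lincomb A S"
| step: "a \<in> A \<Longrightarrow> s \<in> S \<Longrightarrow> w \<in> lincomb A S \<Longrightarrow> fscale a s + w \<in> lincomb A S"

definition preforms :: "'a::comm_ring_1 set \<Rightarrow> (('n \<Rightarrow> 'a) \<Rightarrow>\<^sub>0 'a) set" where
  "preforms A = lincomb A {symb f | f. range f \<subseteq> A}"

inductive_set kaehler_gens :: "'a::comm_ring_1 set \<Rightarrow> 'a set \<Rightarrow> (('n \<Rightarrow> 'a) \<Rightarrow>\<^sub>0 'a) set"
  for K A where
  add: "range f \<subseteq> A \<Longrightarrow> a \<in> A \<Longrightarrow> b \<in> A \<Longrightarrow>
    symb (f(i := a + b)) - symb (f(i := a)) - symb (f(i := b)) \<in> kaehler_gens K A"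
| leibniz: "range f \<subseteq> A \<Longrightarrow> a \<in> A \<Longrightarrow> b \<in> A \<Longrightarrow>
    symb (f(i := a * b)) - fscale a (symb (f(i := b))) - fscale b (symb (f(i := a)))
      \<in> kaehler_gens K A"
| const: "range f \<subseteq> A \<Longrightarrow> c \<in> K \<Longrightarrow> symb (f(i := c)) \<in> kaehler_gens K A"
| alternating: "range f \<subseteq> A \<Longrightarrow> i \<noteq> j \<Longrightarrow> f i = f j \<Longrightarrow> symb f \<in> kaehler_gens K A"

definition kaehler_rels :: "'a::comm_ring_1 set \<Rightarrow> 'a set \<Rightarrow> (('n \<Rightarrow> 'a) \<Rightarrow>\<^sub>0 'a) set" where
  "kaehler_rels K A = lincomb A (kaehler_gens K A)"

definition kaehler_forms :: "'a::comm_ring_1 set \<Rightarrow> 'a set \<Rightarrow> (('n \<Rightarrow> 'a) \<Rightarrow>\<^sub>0 'a) set set" where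
  "kaehler_forms K A =
     preforms A // {(u, v). u \<in> preforms A \<and> v \<in> preforms A \<and> u - v \<in> kaehler_rels K A}"

lemma lookup_fscale [simp]:
  "Poly_Mapping.lookup (fscale c w) s = c * Poly_Mapping.lookup w s"
  unfolding fscale_def by (simp add: Poly_Mapping.map.rep_eq when_def)

lemma fscale_one [simp]: "fscale 1 w = w"
  by (intro poly_mapping_eqI) simp

lemma fscale_zero [simp]: "fscale c 0 = 0"
  by (intro poly_mapping_eqI) simp

lemma fscale_fscale [simp]: "fscale a (fscale b w) = fscale (a * b) w"
  by (intro poly_mapping_eqI) (simp add: mult.assoc)

lemma fscale_add: "fscale c (u + v) = fscale c u + fscale c v"
  by (intro poly_mapping_eqI) (simp add: lookup_add algebra_simps)

lemma fscale_diff: "fscale c (u - v) = fscale c u - fscale c v"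
  by (intro poly_mapping_eqI) (simp add: lookup_minus algebra_simps)

lemma fscale_add_left: "fscale (a + b) w = fscale a w + fscale b w"
  by (intro poly_mapping_eqI) (simp add: lookup_add algebra_simps)

lemma fscale_minus_one: "fscale (- 1) w = - w"
  by (intro poly_mapping_eqI) simp

lemma lincomb_base: "1 \<in> A \<Longrightarrow> s \<in> S \<Longrightarrow> s \<in> lincomb A S"
  using lincomb.step[OF _ _ lincomb.zero, of 1 A s S] by simp

lemma lincomb_add: "u \<in> lincomb A S \<Longrightarrow> v \<in> lincomb A S \<Longrightarrow> u + v \<in> lincomb A S"
  by (induction rule: lincomb.induct) (auto simp: add.assoc intro: lincomb.step)

lemma lincomb_scale:
  assumes "\<And>a b. a \<in> A \<Longrightarrow> b \<in> A \<Longrightarrow> a * b \<in> A"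
  shows "u \<in> lincomb A S \<Longrightarrow> c \<in> A \<Longrightarrow> fscale c u \<in> lincomb A S"
  by (induction rule: lincomb.induct)
    (auto simp: fscale_add intro!: lincomb.intros assms)

lemma lincomb_mono:
  assumes "A \<subseteq> B" "S \<subseteq> T" shows "lincomb A S \<subseteq> lincomb B T"
proof
  fix w assume "w \<in> lincomb A S"
  then show "w \<in> lincomb B T"
    by induction (use assms in \<open>auto intro: lincomb.intros\<close>)
qed

lemma kaehler_gens_mono: "A \<subseteq> B \<Longrightarrow> kaehler_gens K A \<subseteq> kaehler_gens K B"
proof
  fix w assume AB: "A \<subseteq> B" and "w \<in> kaehler_gens K A"
  from this(2) show "w \<in> kaehler_gens K B"
    by cases (use AB in \<open>blast intro: kaehler_gens.intros\<close>)+
qed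

lemma kaehler_rels_mono: "A \<subseteq> B \<Longrightarrow> kaehler_rels K A \<subseteq> kaehler_rels K B"
  unfolding kaehler_rels_def by (intro lincomb_mono kaehler_gens_mono)

lemma kaehler_rels_zero: "0 \<in> kaehler_rels K A"
  by (simp add: kaehler_rels_def lincomb.zero)

lemma kaehler_rels_add:
  "u \<in> kaehler_rels K A \<Longrightarrow> v \<in> kaehler_rels K A \<Longrightarrow> u + v \<in> kaehler_rels K A"
  by (simp add: kaehler_rels_def lincomb_add)

lemma kaehler_rels_scale: "u \<in> kaehler_rels K UNIV \<Longrightarrow> fscale c u \<in> kaehler_rels K UNIV"
  by (simp add: kaehler_rels_def lincomb_scale)

lemma kaehler_rels_minus: "u \<in> kaehler_rels K UNIV \<Longrightarrow> - u \<in> kaehler_rels K UNIV"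
  using kaehler_rels_scale[of u K "- 1"] by (simp add: fscale_minus_one)

text \<open>The module of top-degree forms of the full polynomial ring, as a type.\<close>

definition top_eq ::
  "(('n \<Rightarrow> ('n, 'k::field) mpoly) \<Rightarrow>\<^sub>0 ('n, 'k) mpoly) \<Rightarrow> (('n \<Rightarrow> ('n, 'k) mpoly) \<Rightarrow>\<^sub>0 ('n, 'k) mpoly) \<Rightarrow> bool"
  where "top_eq u v \<longleftrightarrow> u - v \<in> kaehler_rels (range Const) UNIV"

lemma equivp_top_eq: "equivp top_eq"
proof (rule equivpI)
  show "reflp top_eq" by (simp add: reflp_def top_eq_def kaehler_rels_zero)
  show "symp top_eq" unfolding symp_def top_eq_def
    using kaehler_rels_minus by fastforce
  show "transp top_eq" unfolding transp_def top_eq_def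
    using kaehler_rels_add by fastforce
qed

quotient_type (overloaded) ('n, 'k) top_form =
  "('n \<Rightarrow> ('n, 'k::field) mpoly) \<Rightarrow>\<^sub>0 ('n, 'k) mpoly" / top_eq
  by (rule equivp_top_eq)

instantiation top_form :: (type, field) ab_group_add
begin

lift_definition zero_top_form :: "('a, 'b) top_form" is 0 .

lift_definition plus_top_form :: "('a, 'b) top_form \<Rightarrow> ('a, 'b) top_form \<Rightarrow> ('a, 'b) top_form" is "(+)"
  unfolding top_eq_def add_diff_add by (rule kaehler_rels_add)

lift_definition uminus_top_form :: "('a, 'b) top_form \<Rightarrow> ('a, 'b) top_form" is uminus
  unfolding top_eq_def minus_diff_minus by (rule kaehler_rels_minus)

lift_definition minus_top_form :: "('a, 'b) top_form \<Rightarrow> ('a, 'b) top_form \<Rightarrow> ('a, 'b) top_form" is "(-)"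
  unfolding top_eq_def diff_conv_add_uminus[of _ "_ :: (_ \<Rightarrow> _) \<Rightarrow>\<^sub>0 _"]
  using kaehler_rels_add kaehler_rels_minus by (fastforce simp: algebra_simps)

instance
proof
  fix a b c :: "('a, 'b) top_form"
  have eqI: "u = v \<Longrightarrow> top_eq u v"
    for u v :: "('a \<Rightarrow> ('a, 'b) mpoly) \<Rightarrow>\<^sub>0 ('a, 'b) mpoly"
    by (simp add: top_eq_def kaehler_rels_zero)
  show "a + b + c = a + (b + c)" by transfer (rule eqI, simp add: add.assoc)
  show "a + b = b + a" by transfer (rule eqI, simp add: add.commute)
  show "0 + a = a" by transfer (rule eqI, simp)
  show "- a + a = 0" by transfer (rule eqI, simp)
  show "a - b = a + - b" by transfer (rule eqI, simp)
qed

end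

definition top_scale ::
  "('n, 'k::field) mpoly \<Rightarrow> ('n, 'k) top_form \<Rightarrow> ('n, 'k) top_form" where
  "top_scale c \<omega> = abs_top_form (fscale c (rep_top_form \<omega>))"

lemma abs_top_form_eq_iff:
  "abs_top_form u = abs_top_form v \<longleftrightarrow> u - v \<in> kaehler_rels (range Const) UNIV"
  by (simp add: top_form.abs_eq_iff top_eq_def)

lemma abs_top_form_surj: obtains u where "\<omega> = abs_top_form u"
  using Quotient3_abs_rep[OF Quotient3_top_form, of \<omega>] by metis

lemma abs_top_form_add: "abs_top_form u + abs_top_form v = abs_top_form (u + v)"
  by (simp add: plus_top_form.abs_eq)

lemma top_scale_abs [simp]: "top_scale c (abs_top_form u) = abs_top_form (fscale c u)"
proof -
  have "abs_top_form (rep_top_form (abs_top_form u)) = abs_top_form u"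
    by (rule Quotient3_abs_rep[OF Quotient3_top_form])
  then show ?thesis
    unfolding top_scale_def abs_top_form_eq_iff fscale_diff[symmetric]
    by (rule kaehler_rels_scale)
qed

lemma module_top_scale:
  "module (top_scale :: ('n, 'k::field) mpoly \<Rightarrow> ('n, 'k) top_form \<Rightarrow> _)"
proof
  fix a b :: "('n, 'k) mpoly" and x y :: "('n, 'k) top_form"
  obtain u where u: "x = abs_top_form u" by (rule abs_top_form_surj)
  obtain v where v: "y = abs_top_form v" by (rule abs_top_form_surj)
  show "top_scale a (x + y) = top_scale a x + top_scale a y"
    by (simp add: u v abs_top_form_add fscale_add)
  show "top_scale (a + b) x = top_scale a x + top_scale b x"
    by (simp add: u abs_top_form_add fscale_add_left)
  show "top_scale a (top_scale b x) = top_scale (a * b) x"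
    by (simp add: u)
  show "top_scale 1 x = x"
    by (simp add: u)
qed

text \<open>The map on top-degree forms induced by the inclusion of a subalgebra: the class of a
  formal combination goes to its class over the full polynomial ring.\<close>

definition natural_map ::
  "(('n \<Rightarrow> ('n, 'k::field) mpoly) \<Rightarrow>\<^sub>0 ('n, 'k) mpoly) set \<Rightarrow> ('n, 'k) top_form" where
  "natural_map C = abs_top_form (SOME w. w \<in> C)"


section \<open>The Jacobian ideal\<close>

text \<open>That the following ideal exists and is unique, and that it is generated by the Jacobian
  determinants, is shown in \<open>jacobian_ideal_unique\<close> and \<open>jacobian_ideal_eq\<close> below.\<close>

definition jacobian_ideal :: "('n::finite, 'k::field) mpoly set \<Rightarrow> ('n, 'k) mpoly set" where
  "jacobian_ideal R =
     (THE I. is_ideal I \<and>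
        module.span top_scale {top_scale a \<omega> | a \<omega>. a \<in> I} =
        module.span top_scale (natural_map ` kaehler_forms (range Const) R))"

definition pdiff :: "'n \<Rightarrow> ('n, 'k::comm_ring_1) mpoly \<Rightarrow> ('n, 'k) mpoly" where
  "pdiff i f = (\<Sum>m\<in>Poly_Mapping.keys f.
     Poly_Mapping.single (m - Poly_Mapping.single i 1)
       (of_nat (Poly_Mapping.lookup m i) * Poly_Mapping.lookup f m))"

definition jacobian :: "('n \<Rightarrow> ('n::finite, 'k::comm_ring_1) mpoly) \<Rightarrow> ('n, 'k) mpoly" where
  "jacobian F = det (\<chi> i j. pdiff j (F i))"

section \<open>Existence and uniqueness of the Jacobian ideal\<close>

lemma poly_mapping_single_induct [case_names zero single add]:
  fixes f :: "'a \<Rightarrow>\<^sub>0 'b::monoid_add"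
  assumes "P 0" and "\<And>m c. P (Poly_Mapping.single m c)" and "\<And>f g. P f \<Longrightarrow> P g \<Longrightarrow> P (f + g)"
  shows "P f"
proof (induction f rule: update_induct)
  case const
  show ?case by (rule assms(1))
next
  case (update f a b)
  have "Poly_Mapping.update a b f = f + Poly_Mapping.single a b"
    using update.hyps(1)
    by (intro poly_mapping_eqI) (auto simp: lookup_update lookup_add lookup_single when_def in_keys_iff)
  then show ?case
    using assms(2,3) update.IH by metis
qed

lemma mpoly_induct [case_names Const Var add mult]:
  fixes f :: "('n, 'k::comm_ring_1) mpoly"
  assumes Const: "\<And>c. P (Const c)" and Var: "\<And>i. P (Var i)"
    and add: "\<And>f g. P f \<Longrightarrow> P g \<Longrightarrow> P (f + g)" and mult: "\<And>f g. P f \<Longrightarrow> P g \<Longrightarrow> P (f * g)"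
  shows "P f"
proof -
  have one: "P (Poly_Mapping.single 0 1)"
    using Const[of 1] by (simp add: Const_def)
  have monom: "P (Poly_Mapping.single m 1)" for m :: "'n \<Rightarrow>\<^sub>0 nat"
  proof (induction m rule: poly_mapping_single_induct)
    case zero
    show ?case by (rule one)
  next
    case (single i k)
    show ?case
    proof (induction k)
      case 0
      show ?case using one by simp
    next
      case (Suc k)
      have "Poly_Mapping.single (Poly_Mapping.single i (Suc k)) 1
          = Var i * Poly_Mapping.single (Poly_Mapping.single i k) (1::'k)"
        by (simp add: Var_def mult_single flip: single_add)
      then show ?case using mult[OF Var Suc] by simp
    qed
  next
    case (add f g)
    have "Poly_Mapping.single (f + g) 1
        = Poly_Mapping.single f 1 * Poly_Mapping.single g (1::'k)"
      by (simp add: mult_single)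
    then show ?case using mult[OF add] by simp
  qed
  show ?thesis
  proof (induction f rule: poly_mapping_single_induct)
    case zero
    show ?case using Const[of 0] by (simp add: Const_def)
  next
    case (single m c)
    have "Poly_Mapping.single m c = Const c * Poly_Mapping.single m 1"
      by (simp add: Const_def mult_single)
    then show ?case using mult[OF Const monom] by simp
  qed (rule add)
qed

lemma pdiff_single: "pdiff i (Poly_Mapping.single m c)
  = Poly_Mapping.single (m - Poly_Mapping.single i 1) (of_nat (Poly_Mapping.lookup m i) * c)"
  by (simp add: pdiff_def)

lemma pdiff_add: "pdiff i (f + g) = pdiff i f + pdiff i g"
  unfolding pdiff_def
  by (rule setsum_keys_plus_distrib) (simp_all add: algebra_simps single_add)

lemma pdiff_zero [simp]: "pdiff i 0 = 0"
  by (simp add: pdiff_def)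

lemma pdiff_Const [simp]: "pdiff i (Const c) = 0"
  by (simp add: Const_def pdiff_single)

lemma pdiff_Var: "pdiff i (Var j) = (if i = j then 1 else 0)"
  by (auto simp: Var_def pdiff_single lookup_single when_def)

lemma pdiff_mult_single:
  fixes c d :: "'k::comm_ring_1"
  shows "pdiff i (Poly_Mapping.single m c * Poly_Mapping.single m' d)
    = Poly_Mapping.single m c * pdiff i (Poly_Mapping.single m' d)
      + Poly_Mapping.single m' d * pdiff i (Poly_Mapping.single m c)"
proof -
  have shift: "Poly_Mapping.single (a + (b - Poly_Mapping.single i 1)) (of_nat (Poly_Mapping.lookup b i) * e)
    = Poly_Mapping.single (a + b - Poly_Mapping.single i 1) (of_nat (Poly_Mapping.lookup b i) * e)"
    for a b :: "'a \<Rightarrow>\<^sub>0 nat" and e :: 'k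
  proof (cases "Poly_Mapping.lookup b i = 0")
    case False
    then have "a + (b - Poly_Mapping.single i 1) = a + b - Poly_Mapping.single i 1"
      by (intro poly_mapping_eqI) (auto simp: lookup_add lookup_minus lookup_single when_def)
    then show ?thesis by simp
  qed simp
  show ?thesis
    using shift[of m m' "c * d"] shift[of m' m "c * d"]
    by (simp add: mult_single pdiff_single lookup_add algebra_simps flip: single_add)
qed

lemma pdiff_mult:
  fixes f g :: "('n, 'k::comm_ring_1) mpoly"
  shows "pdiff i (f * g) = f * pdiff i g + g * pdiff i f"
proof (induction f rule: poly_mapping_single_induct)
  case (single m c)
  show ?case
    by (induction g rule: poly_mapping_single_induct)
      (simp_all add: pdiff_mult_single pdiff_add algebra_simps)
qed (simp_all add: pdiff_add algebra_simps)

text \<open>Alternating maps that are derivations in every slot.\<close>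

locale alternating_derivation = module scale
  for scale :: "('n::finite, 'k::field) mpoly \<Rightarrow> 'b::ab_group_add \<Rightarrow> 'b" (infixr \<open>*s\<close> 75) +
  fixes G :: "('n \<Rightarrow> ('n, 'k) mpoly) \<Rightarrow> 'b"
  assumes slot_add: "G (f(i := a + b)) = G (f(i := a)) + G (f(i := b))"
    and slot_mult: "G (f(i := a * b)) = a *s G (f(i := b)) + b *s G (f(i := a))"
    and slot_Const: "G (f(i := Const c)) = 0"
    and alternating: "i \<noteq> j \<Longrightarrow> f i = f j \<Longrightarrow> G f = 0"
begin

lemma swap:
  assumes "i \<noteq> j"
  shows "G (f(i := a, j := b)) = - G (f(i := b, j := a))"
proof -
  have eq0: "G (f(i := c, j := c)) = 0" for c
    using assms by (intro alternating[of i j]) auto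
  have split_i: "G (f(i := a + b, j := c)) = G (f(i := a, j := c)) + G (f(i := b, j := c))" for c
    using slot_add[of "f(j := c)" i a b] by (simp only: fun_upd_twist[OF assms])
  have "G (f(i := a + b, j := a + b)) = G (f(i := a + b, j := a)) + G (f(i := a + b, j := b))"
    by (rule slot_add)
  then have "G (f(i := a, j := b)) + G (f(i := b, j := a)) = 0"
    unfolding eq0 split_i by (simp add: add.commute)
  then show ?thesis by (simp only: eq_neg_iff_add_eq_0)
qed

lemma expand: "G (f(i := a)) = (\<Sum>j\<in>UNIV. pdiff j a *s G (f(i := Var j)))"
proof (induction a rule: mpoly_induct)
  case (Const c)
  show ?case using slot_Const[of f i c] by (simp del: fun_upd_apply)
next
  case (Var l)
  have "(\<Sum>j\<in>UNIV. pdiff j (Var l) *s G (f(i := Var j)))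
      = (\<Sum>j\<in>UNIV. if j = l then G (f(i := Var j)) else 0)"
    by (intro sum.cong) (simp_all add: pdiff_Var)
  then show ?case by (simp del: fun_upd_apply)
next
  case (add a b)
  then show ?case by (simp add: slot_add pdiff_add scale_left_distrib sum.distrib del: fun_upd_apply)
next
  case (mult a b)
  then show ?case
    by (simp add: slot_mult pdiff_mult scale_left_distrib sum.distrib scale_sum_right del: fun_upd_apply)
qed

lemma eq_0:
  assumes "G Var = 0"
  shows "G f = 0"
proof (induction "card {i. f i \<noteq> Var i}" arbitrary: f rule: less_induct)
  case less
  show ?case
  proof (cases "\<exists>i. f i \<noteq> Var i")
    case False
    then have "f = Var" by auto
    then show ?thesis using assms by simp
  next
    case True
    then obtain i where i: "f i \<noteq> Var i" by blast
    have "G (f(i := Var j)) = 0" for j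
    proof (cases "j \<noteq> i \<and> f j = Var j")
      case True
      then show ?thesis by (intro alternating[of i j]) auto
    next
      case False
      have IH: "G g = 0" if "g j = Var j" "\<And>l. l \<noteq> i \<Longrightarrow> l \<noteq> j \<Longrightarrow> g l = f l" for g
      proof (rule less)
        have "j \<notin> {l. g l \<noteq> Var l}" "j \<in> {l. f l \<noteq> Var l}"
          using that(1) i False by auto
        moreover have "{l. g l \<noteq> Var l} \<subseteq> {l. f l \<noteq> Var l}"
          using that i by (metis (mono_tags, lifting) mem_Collect_eq subsetI)
        ultimately have "{l. g l \<noteq> Var l} \<subset> {l. f l \<noteq> Var l}" by blast
        then show "card {l. g l \<noteq> Var l} < card {l. f l \<noteq> Var l}"
          by (intro psubset_card_mono) auto
      qed
      show ?thesis
      proof (cases "j = i")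
        case True
        then show ?thesis by (intro IH) auto
      next
        case False
        then have "f(i := Var j, j := f j) = f(i := Var j)"
          by (intro fun_upd_idem) simp
        then have "G (f(i := Var j)) = - G (f(i := f j, j := Var j))"
          using swap[of i j f "Var j" "f j"] False by metis
        also have "G (f(i := f j, j := Var j)) = 0"
          by (rule IH) auto
        finally show ?thesis by (simp del: fun_upd_apply)
      qed
    qed
    then show ?thesis
      using expand[of f i "f i"] by simp
  qed
qed

end

lemma alternating_derivation_jacobian:
  "alternating_derivation (*) (jacobian :: ('n \<Rightarrow> ('n::finite, 'k::field) mpoly) \<Rightarrow> _)"
proof (intro alternating_derivation.intro module_times alternating_derivation_axioms.intro)
  fix f :: "'n \<Rightarrow> ('n, 'k) mpoly" and a b :: "('n, 'k) mpoly" and i j :: 'n and c :: 'k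
  have upd: "jacobian (f(i := a))
      = det (\<chi> l. if l = i then \<chi> j. pdiff j a else \<chi> j. pdiff j (f l))" for a
    unfolding jacobian_def by (rule arg_cong[where f = det]) (simp add: vec_eq_iff)
  have sc: "x * jacobian (f(i := a))
      = det (\<chi> l. if l = i then x *s (\<chi> j. pdiff j a) else \<chi> j. pdiff j (f l))" for x a
    by (simp only: upd det_row_mul)
  show "jacobian (f(i := a + b)) = jacobian (f(i := a)) + jacobian (f(i := b))"
    unfolding upd det_row_add[symmetric]
    by (rule arg_cong[where f = det]) (simp add: vec_eq_iff pdiff_add)
  show "jacobian (f(i := a * b)) = a * jacobian (f(i := b)) + b * jacobian (f(i := a))"
    unfolding sc unfolding upd det_row_add[symmetric]
    by (rule arg_cong[where f = det]) (simp add: vec_eq_iff pdiff_mult)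
  have "jacobian (f(i := Const c)) = 0 * jacobian (f(i := Const c))"
    unfolding sc unfolding upd by (rule arg_cong[where f = det]) (simp add: vec_eq_iff)
  then show "jacobian (f(i := Const c)) = 0" by simp
  show "jacobian f = 0" if "i \<noteq> j" "f i = f j"
    unfolding jacobian_def using that
    by (intro det_identical_rows[of i j]) (simp_all add: row_def)
qed

text \<open>The symbol \<open>df\<^sub>1 \<and> \<dots> \<and> df\<^sub>n\<close> over the full polynomial ring.\<close>

definition wedge :: "('n \<Rightarrow> ('n, 'k::field) mpoly) \<Rightarrow> ('n, 'k) top_form" where
  "wedge f = abs_top_form (symb f)"

interpretation top: module "top_scale :: ('n, 'k::field) mpoly \<Rightarrow> ('n, 'k) top_form \<Rightarrow> _"
  by (rule module_top_scale)

lemma kaehler_gens_rels: "w \<in> kaehler_gens K UNIV \<Longrightarrow> w \<in> kaehler_rels K UNIV"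
  by (simp add: kaehler_rels_def lincomb_base)

lemma abs_top_form_diff: "abs_top_form u - abs_top_form v = abs_top_form (u - v)"
  by (simp add: minus_top_form.abs_eq)

lemma abs_top_form_0: "abs_top_form 0 = 0"
  by (simp add: zero_top_form_def)

lemma abs_top_form_eq_0: "w \<in> kaehler_gens (range Const) UNIV \<Longrightarrow> abs_top_form w = 0"
  using abs_top_form_eq_iff[of w 0] by (simp add: abs_top_form_0 kaehler_gens_rels)

lemma alternating_derivation_wedge:
  "alternating_derivation top_scale (wedge :: ('n \<Rightarrow> ('n::finite, 'k::field) mpoly) \<Rightarrow> _)"
proof (intro alternating_derivation.intro module_top_scale alternating_derivation_axioms.intro)
  fix f :: "'n \<Rightarrow> ('n, 'k) mpoly" and a b :: "('n, 'k) mpoly" and i j :: 'n and c :: 'k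
  have "wedge (f(i := a + b)) - wedge (f(i := a)) - wedge (f(i := b)) = 0"
    unfolding wedge_def abs_top_form_diff
    by (intro abs_top_form_eq_0 kaehler_gens.add) auto
  then show "wedge (f(i := a + b)) = wedge (f(i := a)) + wedge (f(i := b))"
    by (simp add: algebra_simps)
  have "wedge (f(i := a * b)) - top_scale a (wedge (f(i := b))) - top_scale b (wedge (f(i := a))) = 0"
    unfolding wedge_def abs_top_form_diff top_scale_abs
    by (intro abs_top_form_eq_0 kaehler_gens.leibniz) auto
  then show "wedge (f(i := a * b)) = top_scale a (wedge (f(i := b))) + top_scale b (wedge (f(i := a)))"
    by (simp add: algebra_simps)
  show "wedge (f(i := Const c)) = 0"
    unfolding wedge_def by (intro abs_top_form_eq_0 kaehler_gens.const) auto
  show "wedge f = 0" if "i \<noteq> j" "f i = f j"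
    unfolding wedge_def
    by (rule abs_top_form_eq_0, rule kaehler_gens.alternating[OF _ that]) simp
qed

lemma jacobian_Var [simp]: "jacobian Var = 1"
proof -
  have "(\<chi> i j. pdiff j (Var i)) = (mat 1 :: ('a, 'b) mpoly ^ 'a ^ 'a)"
    by (auto simp: vec_eq_iff mat_def pdiff_Var)
  then show ?thesis by (simp add: jacobian_def)
qed

lemma wedge_eq_jacobian:
  fixes F :: "'n \<Rightarrow> ('n::finite, 'k::field) mpoly"
  shows "wedge F = top_scale (jacobian F) (wedge Var)"
proof -
  interpret J: alternating_derivation "(*)" "jacobian :: ('n \<Rightarrow> ('n, 'k) mpoly) \<Rightarrow> _"
    by (rule alternating_derivation_jacobian)
  interpret W: alternating_derivation top_scale "wedge :: ('n \<Rightarrow> ('n, 'k) mpoly) \<Rightarrow> _"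
    by (rule alternating_derivation_wedge)
  interpret D: alternating_derivation top_scale
    "\<lambda>F :: 'n \<Rightarrow> ('n, 'k) mpoly. wedge F - top_scale (jacobian F) (wedge Var)"
  proof (unfold_locales, goal_cases)
    case (1 f i a b)
    show ?case
      unfolding W.slot_add J.slot_add by (simp add: algebra_simps)
  next
    case (2 f i a b)
    show ?case
      unfolding W.slot_mult J.slot_mult by (simp add: algebra_simps)
  next
    case (3 f i c)
    show ?case
      unfolding W.slot_Const J.slot_Const by simp
  next
    case (4 i j f)
    show ?case
      unfolding W.alternating[OF 4] J.alternating[OF 4] by simp
  qed
  show ?thesis using D.eq_0[of F] by simp
qed

definition preform_det ::
  "(('n \<Rightarrow> ('n::finite, 'k::field) mpoly) \<Rightarrow>\<^sub>0 ('n, 'k) mpoly) \<Rightarrow> ('n, 'k) mpoly" where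
  "preform_det w = (\<Sum>F\<in>Poly_Mapping.keys w. Poly_Mapping.lookup w F * jacobian F)"

lemma preform_det_add: "preform_det (u + v) = preform_det u + preform_det v"
  unfolding preform_det_def by (rule setsum_keys_plus_distrib) (simp_all add: algebra_simps)

lemma preform_det_fscale: "preform_det (fscale c u) = c * preform_det u"
proof -
  have "preform_det (fscale c u)
      = (\<Sum>F\<in>Poly_Mapping.keys u. Poly_Mapping.lookup (fscale c u) F * jacobian F)"
    unfolding preform_det_def by (rule sum.mono_neutral_left) (auto simp: in_keys_iff)
  then show ?thesis by (simp add: preform_det_def sum_distrib_left mult.assoc)
qed

lemma preform_det_diff: "preform_det (u - v) = preform_det u - preform_det v"
  using preform_det_add[of "u - v" v] by simp

lemma preform_det_symb [simp]: "preform_det (symb F) = jacobian F"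
  by (simp add: preform_det_def symb_def)

lemma preform_det_rels:
  assumes "w \<in> kaehler_rels (range Const) UNIV"
  shows "preform_det (w :: ('n \<Rightarrow> ('n::finite, 'k::field) mpoly) \<Rightarrow>\<^sub>0 ('n, 'k) mpoly) = 0"
proof -
  interpret J: alternating_derivation "(*)" "jacobian :: ('n \<Rightarrow> ('n, 'k) mpoly) \<Rightarrow> _"
    by (rule alternating_derivation_jacobian)
  have gens: "preform_det s = 0" if "s \<in> kaehler_gens (range Const) UNIV"
    for s :: "('n \<Rightarrow> ('n, 'k) mpoly) \<Rightarrow>\<^sub>0 ('n, 'k) mpoly"
    using that
    by cases (auto simp: preform_det_diff preform_det_fscale J.slot_add J.slot_mult J.slot_Const
        intro: J.alternating)
  show ?thesis
    using assms unfolding kaehler_rels_def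
    by induction (simp_all add: preform_det_add preform_det_fscale gens, simp add: preform_det_def)
qed

text \<open>The forms of top degree are free of rank one on \<open>dx\<^sub>1 \<and> \<dots> \<and> dx\<^sub>n\<close>.\<close>

lemma top_scale_wedge_Var_inj:
  fixes a b :: "('n::finite, 'k::field) mpoly"
  assumes "top_scale a (wedge Var) = top_scale b (wedge Var)"
  shows "a = b"
proof -
  have "preform_det (fscale a (symb Var) - fscale b (symb Var)) = 0"
    by (rule preform_det_rels) (use assms in \<open>simp add: wedge_def abs_top_form_eq_iff\<close>)
  then show ?thesis by (simp add: preform_det_diff preform_det_fscale)
qed


lemma abs_top_form_preform_det:
  "abs_top_form w = top_scale (preform_det w) (wedge Var)"
proof (induction w rule: poly_mapping_single_induct)
  case zero
  show ?case by (simp add: abs_top_form_0 preform_det_def)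
next
  case (single F c)
  have "Poly_Mapping.single F c = fscale c (symb F)"
    by (intro poly_mapping_eqI) (simp add: symb_def lookup_single when_def)
  then show ?case
    using wedge_eq_jacobian[of F]
    by (simp add: preform_det_fscale wedge_def flip: top_scale_abs)
next
  case (add u v)
  then show ?case by (simp add: preform_det_add top.scale_left_distrib flip: abs_top_form_add)
qed

lemma top_form_exhaust:
  fixes \<omega> :: "('n::finite, 'k::field) top_form"
  obtains a where "\<omega> = top_scale a (wedge Var)"
proof -
  obtain w where "\<omega> = abs_top_form w" by (rule abs_top_form_surj)
  then show thesis by (rule that[OF trans[OF _ abs_top_form_preform_det]])
qed

lemma natural_map_kaehler_forms:
  fixes R :: "('n, 'k::field) mpoly set"
  shows "natural_map ` kaehler_forms (range Const) R = abs_top_form ` preforms R"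
proof -
  define E :: "((('n \<Rightarrow> ('n, 'k) mpoly) \<Rightarrow>\<^sub>0 ('n, 'k) mpoly) \<times> _) set" where
    "E = {(u, v). u \<in> preforms R \<and> v \<in> preforms R \<and> u - v \<in> kaehler_rels (range Const) R}"
  have nat: "natural_map (E `` {u}) = abs_top_form u" if u: "u \<in> preforms R" for u
  proof -
    have "u \<in> E `` {u}" using u by (simp add: E_def kaehler_rels_zero)
    then have "(SOME w. w \<in> E `` {u}) \<in> E `` {u}" by (rule someI)
    then have "u - (SOME w. w \<in> E `` {u}) \<in> kaehler_rels (range Const) R"
      unfolding E_def by blast
    then have "u - (SOME w. w \<in> E `` {u}) \<in> kaehler_rels (range Const) UNIV"
      by (rule subsetD[OF kaehler_rels_mono[OF subset_UNIV]])
    then show ?thesis by (simp add: natural_map_def abs_top_form_eq_iff[symmetric])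
  qed
  have "kaehler_forms (range Const) R = (\<lambda>u. E `` {u}) ` preforms R"
    by (auto simp: kaehler_forms_def quotient_def E_def)
  then show ?thesis by (simp add: image_image nat)
qed

lemma span_natural_map:
  fixes R :: "('n::finite, 'k::field) mpoly set"
  assumes "subalgebra R"
  shows "module.span top_scale (natural_map ` kaehler_forms (range Const) R)
    = (\<lambda>a. top_scale a (wedge Var)) ` ideal_gen {jacobian F | F. range F \<subseteq> R}"
    (is "_ = ?f ` ?J")
proof
  interpret I: module "(*) :: ('n, 'k) mpoly \<Rightarrow> _" by (rule module_times)
  have one: "1 \<in> R"
    using assms by (metis Const_def rangeI single_one subalgebra_def subsetD)
  have sub: "top.subspace (?f ` ?J)"
  proof (rule top.subspaceI)
    show "0 \<in> ?f ` ?J"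
      using I.span_zero by (auto simp: ideal_gen_def image_iff intro!: bexI[of _ 0])
    show "x + y \<in> ?f ` ?J" if "x \<in> ?f ` ?J" "y \<in> ?f ` ?J" for x y
      using that by (auto simp: ideal_gen_def simp flip: top.scale_left_distrib intro: I.span_add)
    show "top_scale c x \<in> ?f ` ?J" if "x \<in> ?f ` ?J" for c x
      using that by (auto simp: ideal_gen_def intro: I.span_scale)
  qed
  have "abs_top_form w \<in> ?f ` ?J" if "w \<in> preforms R" for w
    using that unfolding preforms_def
  proof induction
    case zero
    show ?case using top.subspace_0[OF sub] by (simp add: abs_top_form_0)
  next
    case (step a s w)
    then obtain F where F: "s = symb F" "range F \<subseteq> R" by blast
    have "abs_top_form s \<in> ?f ` ?J"
      using F wedge_eq_jacobian[of F] unfolding ideal_gen_def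
      by (intro image_eqI[where x = "jacobian F"]) (auto simp: wedge_def intro!: I.span_base)
    then show ?case
      using step.IH top.subspace_add[OF sub] top.subspace_scale[OF sub]
      by (simp flip: abs_top_form_add top_scale_abs)
  qed
  then show "top.span (natural_map ` kaehler_forms (range Const) R) \<subseteq> ?f ` ?J"
    unfolding natural_map_kaehler_forms by (intro top.span_minimal sub) auto
  have jacobian_mem: "top_scale (jacobian F) (wedge Var) \<in> top.span (abs_top_form ` preforms R)"
    if "range F \<subseteq> R" for F
  proof -
    have "symb F \<in> preforms R"
      unfolding preforms_def using that one by (intro lincomb_base) auto
    then have "wedge F \<in> top.span (abs_top_form ` preforms R)"
      unfolding wedge_def by (intro top.span_base) auto
    then show ?thesis by (simp only: wedge_eq_jacobian[of F])
  qed
  have "top_scale a (wedge Var) \<in> top.span (abs_top_form ` preforms R)" if "a \<in> ?J" for a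
    using that unfolding ideal_gen_def
  proof (induction rule: I.span_induct_alt)
    case base
    show ?case by (simp add: top.span_zero)
  next
    case (step c x y)
    then have "top_scale x (wedge Var) \<in> top.span (abs_top_form ` preforms R)"
      using jacobian_mem by blast
    then have "top_scale c (top_scale x (wedge Var)) \<in> top.span (abs_top_form ` preforms R)"
      by (rule top.span_scale)
    then show ?case
      using step by (simp add: top.scale_left_distrib top.span_add)
  qed
  then show "?f ` ?J \<subseteq> top.span (natural_map ` kaehler_forms (range Const) R)"
    unfolding natural_map_kaehler_forms by auto
qed

lemma ideal_times_top_forms:
  fixes I :: "('n::finite, 'k::field) mpoly set"
  assumes "is_ideal I"
  shows "module.span top_scale {top_scale a \<omega> | a \<omega>. a \<in> I} = (\<lambda>a. top_scale a (wedge Var)) ` I"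
    (is "top.span ?S = ?f ` I")
proof (rule antisym)
  interpret I: module "(*) :: ('n, 'k) mpoly \<Rightarrow> _" by (rule module_times)
  have I: "I.subspace I" using assms by (simp add: is_ideal_def)
  have sub: "top.subspace (?f ` I)"
  proof (rule top.subspaceI)
    show "0 \<in> ?f ` I"
      using I.subspace_0[OF I] by (auto simp: image_iff intro!: bexI[of _ 0])
    show "x + y \<in> ?f ` I" if "x \<in> ?f ` I" "y \<in> ?f ` I" for x y
      using that by (auto simp flip: top.scale_left_distrib intro: I.subspace_add[OF I])
    show "top_scale c x \<in> ?f ` I" if "x \<in> ?f ` I" for c x
      using that by (auto intro: I.subspace_scale[OF I])
  qed
  have "top_scale a \<omega> \<in> ?f ` I" if a: "a \<in> I" for a \<omega>
  proof -
    obtain b where "\<omega> = top_scale b (wedge Var)" by (rule top_form_exhaust)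
    then show ?thesis
      using I.subspace_scale[OF I a, of b] by (auto simp: mult.commute)
  qed
  then show "top.span ?S \<subseteq> ?f ` I"
    by (intro top.span_minimal sub) auto
  show "?f ` I \<subseteq> top.span ?S"
    by (auto intro!: top.span_base)
qed

lemma is_ideal_ideal_gen: "is_ideal (ideal_gen S)"
  unfolding is_ideal_def ideal_gen_def by (rule module.subspace_span[OF module_times])

lemma jacobian_ideal_unique:
  fixes R :: "('n::finite, 'k::field) mpoly set"
  assumes "subalgebra R"
  shows "is_ideal I \<and>
      module.span top_scale {top_scale a \<omega> | a \<omega>. a \<in> I} =
      module.span top_scale (natural_map ` kaehler_forms (range Const) R)
    \<longleftrightarrow> I = ideal_gen {jacobian F | F. range F \<subseteq> R}"
proof -
  let ?f = "\<lambda>a :: ('n, 'k) mpoly. top_scale a (wedge Var)"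
  let ?J = "ideal_gen {jacobian F | F. range F \<subseteq> R}"
  have inj: "inj ?f"
    by (rule injI) (rule top_scale_wedge_Var_inj)
  show ?thesis
  proof (cases "is_ideal I")
    case True
    then show ?thesis
      unfolding span_natural_map[OF assms] ideal_times_top_forms[OF True]
      by (simp only: inj_image_eq_iff[OF inj] simp_thms)
  next
    case False
    then show ?thesis using is_ideal_ideal_gen by blast
  qed
qed

theorem jacobian_ideal_eq:
  fixes R :: "('n::finite, 'k::field) mpoly set"
  assumes "subalgebra R"
  shows "jacobian_ideal R = ideal_gen {jacobian F | F. range F \<subseteq> R}"
  unfolding jacobian_ideal_def jacobian_ideal_unique[OF assms] by simp

end

theory Submission
  imports Defs "HOL-Computational_Algebra.Polynomial"
begin

text \<open>
  Let \<open>B = R[X\<^sup>p]\<close> and let \<open>F\<close> be an \<open>n\<close>-tuple in \<open>R\<close>.  With a second set of variables \<open>x = y + u\<close>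
  write \<open>f\<^sub>i(x) - f\<^sub>i(y) = \<Sum>\<^sub>j h\<^sub>i\<^sub>j u\<^sub>j\<close>, where \<open>h\<^sub>i\<^sub>j\<close> has constant term \<open>\<partial>f\<^sub>i/\<partial>x\<^sub>j\<close>.  Modulo the \<open>u\<^sub>j\<^sup>p\<close>
  one has \<open>\<Prod>\<^sub>i (f\<^sub>i(x) - f\<^sub>i(y))\<^sup>p\<^sup>-\<^sup>1 = det(h)\<^sup>p\<^sup>-\<^sup>1 \<Prod>\<^sub>j u\<^sub>j\<^sup>p\<^sup>-\<^sup>1\<close>.  Multiply by \<open>a(x)\<close> and take the coefficient
  of \<open>\<Prod>\<^sub>j u\<^sub>j\<^sup>p\<^sup>-\<^sup>1\<close>: the right-hand side gives \<open>j(F)\<^sup>p\<^sup>-\<^sup>1 a\<close>, and the left-hand side lies in \<open>B\<close>,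
  because that coefficient of \<open>b(y + u)\<close> is a polynomial in the \<open>y\<^sub>j\<^sup>p\<close> for every \<open>b\<close>.  So \<open>j(F)\<^sup>p\<^sup>-\<^sup>1\<close> is in
  the conductor of \<open>B\<close>.  If \<open>J(R) = (d)\<close>, the quotients \<open>j(F)/d\<close> generate the unit ideal, hence
  so do their powers, and \<open>d\<^sup>p\<^sup>-\<^sup>1\<close> is in the conductor; finally \<open>q \<ge> p - 1\<close>.
\<close>

section \<open>Determinants over commutative rings\<close>

lemma ideal_zero: "is_ideal I \<Longrightarrow> 0 \<in> I"
  and ideal_add: "is_ideal I \<Longrightarrow> a \<in> I \<Longrightarrow> b \<in> I \<Longrightarrow> a + b \<in> I"
  and ideal_mult_left: "is_ideal I \<Longrightarrow> b \<in> I \<Longrightarrow> c * b \<in> I"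
  and ideal_mult_right: "is_ideal I \<Longrightarrow> b \<in> I \<Longrightarrow> b * c \<in> I"
  and ideal_diff: "is_ideal I \<Longrightarrow> a \<in> I \<Longrightarrow> b \<in> I \<Longrightarrow> a - b \<in> I"
  and ideal_sum: "is_ideal I \<Longrightarrow> (\<And>x. x \<in> X \<Longrightarrow> f x \<in> I) \<Longrightarrow> sum f X \<in> I"
  for I :: "'a::comm_ring_1 set"
  using module.subspace_0[OF module_times] module.subspace_add[OF module_times]
    module.subspace_scale[OF module_times] module.subspace_diff[OF module_times]
    module.subspace_sum[OF module_times]
  unfolding is_ideal_def by (blast, blast, blast, metis mult.commute, blast, metis)

lemma is_idealI:
  fixes I :: "'a::comm_ring_1 set"
  assumes "0 \<in> I" "\<And>a b. a \<in> I \<Longrightarrow> b \<in> I \<Longrightarrow> a + b \<in> I" "\<And>c b. b \<in> I \<Longrightarrow> c * b \<in> I"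
  shows "is_ideal I"
  unfolding is_ideal_def by (rule module.subspaceI[OF module_times]) (fact assms)+

section \<open>Adjugates and Cramer's rule without division\<close>

lemma det_row_replace_lincomb:
  fixes A :: "'a::comm_ring_1 ^ 'n ^ 'n"
  shows "det (\<chi> i. if i = k then \<Sum>l\<in>UNIV. x l *s row l A else row i A) = x k * det A"
proof -
  have "det (\<chi> i. if i = k then row l A else row i A) = (if l = k then det A else 0)" for l
  proof (cases "l = k")
    case True
    then have "(\<chi> i. if i = k then row l A else row i A) = A"
      by (simp add: row_def vec_eq_iff)
    with True show ?thesis by simp
  next
    case False
    then show ?thesis
      by (auto intro!: det_identical_rows[of l k] simp: row_def vec_eq_iff)
  qed
  then show ?thesis
    by (simp add: det_linear_row_sum det_row_mul if_distrib[of "(*) _"] cong: if_cong)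
qed

text \<open>\<open>B\<close> is the matrix of cofactors: by linearity in one row, entry
  \<open>(l, i)\<close> of the product is the determinant of \<open>A\<close> with row
  \<open>i\<close> overwritten by row \<open>l\<close>.\<close>

lemma ex_right_adjugate:
  fixes A :: "'a::comm_ring_1 ^ 'n ^ 'n"
  obtains B where "A ** B = mat (det A)"
proof
  define B :: "'a ^ 'n ^ 'n" where
    "B = (\<chi> j i. det (\<chi> l. if l = i then axis j 1 else row l A))"
  have "(A ** B) $ l $ i = mat (det A) $ l $ i" for l i
  proof -
    have "row l A = (\<Sum>j\<in>UNIV. A $ l $ j *s axis j 1)"
      by (simp add: row_def vec_eq_iff axis_def if_distrib[of "(*) _"] cong: if_cong)
    then have "(A ** B) $ l $ i = det (\<chi> l'. if l' = i then row l A else row l' A)"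
      by (simp add: matrix_matrix_mult_def B_def det_linear_row_sum det_row_mul cong: if_cong)
    also have "row l A = (\<Sum>l'\<in>UNIV. (if l' = l then 1 else 0) *s row l' A)"
      by (simp add: vec_eq_iff if_distrib[of "\<lambda>x. x * _"] cong: if_cong)
    finally show ?thesis
      by (simp add: det_row_replace_lincomb mat_def)
  qed
  then show "A ** B = mat (det A)"
    by (simp add: vec_eq_iff)
qed

lemma ex_left_adjugate:
  fixes A :: "'a::comm_ring_1 ^ 'n ^ 'n"
  obtains C where "C ** A = mat (det A)"
proof -
  obtain B where "transpose A ** B = mat (det (transpose A))"
    by (rule ex_right_adjugate)
  then have "transpose B ** A = transpose (mat (det A))"
    by (metis det_transpose matrix_transpose_mul transpose_transpose)
  then show thesis
    using that by (simp add: transpose_mat)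
qed

text \<open>The coefficients are the entries of \<open>r\<close> times a left adjugate. Computing
  the determinant with row \<open>k\<close> replaced by \<open>det A *s r\<close> in two ways gives
  the second equation; \<open>det A\<close> stays on both sides because it may be a zero
  divisor.\<close>

lemma cramer_row:
  fixes A :: "'a::comm_ring_1 ^ 'n ^ 'n"
  obtains x where "det A *s r = (\<Sum>l\<in>UNIV. x l *s row l A)"
    and "x k * det A = det A * det (\<chi> i. if i = k then r else row i A)"
proof -
  obtain C where C: "C ** A = mat (det A)"
    by (rule ex_left_adjugate)
  define x where "x = (\<lambda>l. (r v* C) $ l)"
  have "r v* (C ** A) = (\<Sum>l\<in>UNIV. x l *s row l A)"
    by (simp add: x_def vector_matrix_mul_assoc[symmetric])
       (simp add: vector_matrix_mult_def vec_eq_iff row_def mult.commute)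
  then have x: "det A *s r = (\<Sum>l\<in>UNIV. x l *s row l A)"
    unfolding C by (simp add: vector_matrix_mult_def vec_eq_iff mat_def
        if_distrib[of "\<lambda>x. x * _"] if_distrib[of "\<lambda>x. _ * x"] mult.commute cong: if_cong)
  have "x k * det A = det (\<chi> i. if i = k then det A *s r else row i A)"
    unfolding x by (rule det_row_replace_lincomb[symmetric])
  also have "\<dots> = det A * det (\<chi> i. if i = k then r else row i A)"
    by (rule det_row_mul)
  finally show thesis
    using x that by blast
qed

section \<open>Top powers of linear forms in nilpotent elements\<close>

lemma ideal_power_mult_absorb:
  fixes I :: "'a::comm_ring_1 set"
  assumes "is_ideal I" "s * w \<in> I"
  shows "(z + s) ^ m * w - z ^ m * w \<in> I"
proof -
  have "(z + s) ^ m * w - z ^ m * w = ((z + s) ^ m - z ^ m) * w"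
    by (simp add: algebra_simps)
  also have "\<dots> = (\<Sum>i<m. z ^ (m - Suc i) * (z + s) ^ i) * (s * w)"
    by (simp add: power_diff_sumr2 mult_ac)
  finally show ?thesis
    using assms by (simp add: ideal_mult_left)
qed

text \<open>Cramer's rule writes \<open>det A\<close> times the new linear form as
  \<open>x k\<close> times the old one plus a combination \<open>s\<close> of the forms of the other
  rows. Multiplied by the \<open>m\<close>-th powers of those forms, \<open>s\<close> falls into
  \<open>I\<close>. Hence the claim holds after multiplication by \<open>det A ^ m\<close>, which
  \<open>regular\<close> cancels.\<close>

lemma top_power_replace_row:
  fixes A :: "'a::comm_ring_1 ^ 'n ^ 'n" and r :: "'a ^ 'n"
  assumes I: "is_ideal I"
    and regular: "\<And>g. det A * g \<in> I \<Longrightarrow> g \<in> I"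
    and nilpotent: "\<And>i. i \<noteq> k \<Longrightarrow> ((A *v u) $ i) ^ Suc m \<in> I"
    and A: "(\<Prod>i\<in>UNIV. ((A *v u) $ i) ^ m) - det A ^ m * U \<in> I"
  defines "A' \<equiv> \<chi> i. if i = k then r else row i A"
  shows "(\<Prod>i\<in>UNIV. ((A' *v u) $ i) ^ m) - det A' ^ m * U \<in> I"
proof -
  define w where "w = (\<lambda>i. (A *v u) $ i)"
  define W where "W = (\<Prod>i\<in>-{k}. w i ^ m)"
  define v where "v = (A' *v u) $ k"
  obtain x where x: "det A *s r = (\<Sum>l\<in>UNIV. x l *s row l A)"
    and xk: "x k * det A = det A * det A'"
    unfolding A'_def by (rule cramer_row)
  have split_k: "prod f UNIV = f k * prod f (-{k})" for f :: "'n \<Rightarrow> 'a"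
    by (metis Compl_eq_Diff_UNIV UNIV_I finite prod.remove)
  have w': "(A' *v u) $ i = w i" if "i \<noteq> k" for i
    using that by (simp add: w_def A'_def matrix_vector_mult_def row_def)
  then have prod_w': "(\<Prod>i\<in>UNIV. ((A' *v u) $ i) ^ m) = v ^ m * W"
    by (simp add: split_k v_def W_def)
  define s where "s = (\<Sum>l\<in>-{k}. x l * w l)"
  have "det A * v = (\<Sum>j\<in>UNIV. (det A *s r) $ j * u $ j)"
    by (simp add: v_def A'_def matrix_vector_mult_def sum_distrib_left mult.assoc)
  also have "\<dots> = (\<Sum>l\<in>UNIV. x l * w l)"
    unfolding x by (simp add: w_def matrix_vector_mult_def row_def sum_distrib_left
        sum_distrib_right mult.assoc) (rule sum.swap)
  also have "\<dots> = x k * w k + s"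
    unfolding s_def by (metis (no_types, lifting) Compl_eq_Diff_UNIV UNIV_I finite sum.remove)
  finally have v: "det A * v = x k * w k + s" .
  have "x l * w l * W \<in> I" if "l \<in> -{k}" for l
  proof -
    have "x l * w l * W = x l * (\<Prod>i\<in>-{k}-{l}. w i ^ m) * w l ^ Suc m"
      unfolding W_def prod.remove[OF finite that] by (simp add: mult_ac)
    then show ?thesis
      using nilpotent[of l] that I by (simp add: w_def ideal_mult_left del: power_Suc)
  qed
  then have "s * W \<in> I"
    unfolding s_def sum_distrib_right by (intro ideal_sum I)
  then have "(det A * v) ^ m * W - (x k * w k) ^ m * W \<in> I"
    unfolding v by (rule ideal_power_mult_absorb[OF I])
  moreover have "x k ^ m * ((\<Prod>i\<in>UNIV. w i ^ m) - det A ^ m * U) \<in> I"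
    using A I by (simp add: w_def ideal_mult_left)
  ultimately have "(det A * v) ^ m * W - (x k * w k) ^ m * W
      + x k ^ m * ((\<Prod>i\<in>UNIV. w i ^ m) - det A ^ m * U) \<in> I"
    by (rule ideal_add[OF I])
  also have "(det A * v) ^ m * W - (x k * w k) ^ m * W
      + x k ^ m * ((\<Prod>i\<in>UNIV. w i ^ m) - det A ^ m * U)
      = (det A * v) ^ m * W - (x k * det A) ^ m * U"
    by (simp add: split_k W_def algebra_simps power_mult_distrib)
  also have "\<dots> = det A ^ m * (v ^ m * W - det A' ^ m * U)"
    unfolding xk by (simp add: algebra_simps power_mult_distrib)
  finally have "det A ^ m * (v ^ m * W - det A' ^ m * U) \<in> I" .
  moreover have "det A ^ l * g \<in> I \<Longrightarrow> g \<in> I" for g l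
    using regular by (induction l) (auto simp: mult.assoc)
  ultimately show ?thesis
    unfolding prod_w' by blast
qed


section \<open>Polynomials in an auxiliary variable \<open>t\<close>\<close>

lemma is_ideal_coeffs:
  fixes I :: "'a::comm_ring_1 set"
  assumes "is_ideal I"
  shows "is_ideal {g. \<forall>k. coeff g k \<in> I}"
  using assms by (intro is_idealI)
    (auto simp: coeff_mult intro!: ideal_sum intro: ideal_zero ideal_add ideal_mult_left)

text \<open>With constant term 1, \<open>d\<close> is invertible as a power series, so the
  coefficients of \<open>g\<close> are recovered recursively from those of
  \<open>d * g\<close>.\<close>

lemma coeffs_ideal_cancel:
  fixes I :: "'a::comm_ring_1 set"
  assumes I: "is_ideal I" and d: "coeff d 0 = 1" and dg: "\<And>k. coeff (d * g) k \<in> I"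
  shows "coeff g k \<in> I"
proof (induction k rule: less_induct)
  case (less k)
  have "coeff (d * g) k = (\<Sum>i\<le>k. coeff d i * coeff g (k - i))"
    by (rule coeff_mult)
  also have "\<dots> = coeff g k + (\<Sum>i\<in>{..k} - {0}. coeff d i * coeff g (k - i))"
    by (subst sum.remove[of _ 0]) (simp_all add: d)
  finally have "coeff g k
      = coeff (d * g) k - (\<Sum>i\<in>{..k} - {0}. coeff d i * coeff g (k - i))"
    by simp
  also have "\<dots> \<in> I"
    using less by (intro ideal_diff ideal_sum ideal_mult_left I dg) auto
  finally show ?case .
qed

lemma poly_det: "poly (det A) x = det (\<chi> i j. poly (A $ i $ j) x)"
  by (simp add: det_def poly_sum poly_prod)

text \<open>The coefficient at a degree bound replaces the leading coefficient. It may vanish, so it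
  respects sums and products over every commutative ring, even when the actual degree drops.\<close>

definition top_coeff :: "nat \<Rightarrow> 'a::comm_ring_1 poly \<Rightarrow> 'a \<Rightarrow> bool" where
  "top_coeff d g c \<longleftrightarrow> degree g \<le> d \<and> coeff g d = c"

lemma top_coeff_mult:
  assumes "top_coeff d g a" "top_coeff e h b"
  shows "top_coeff (d + e) (g * h) (a * b)"
proof -
  have "coeff (g * h) (d + e) = (\<Sum>i\<le>d + e. coeff g i * coeff h (d + e - i))"
    by (rule coeff_mult)
  also have "\<dots> = (\<Sum>i\<in>{d}. coeff g i * coeff h (d + e - i))"
  proof (rule sum.mono_neutral_right)
    show "\<forall>i\<in>{..d + e} - {d}. coeff g i * coeff h (d + e - i) = 0"
    proof
      fix i assume "i \<in> {..d + e} - {d}"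
      then have "degree g < i \<or> degree h < d + e - i"
        using assms by (auto simp: top_coeff_def)
      then show "coeff g i * coeff h (d + e - i) = 0"
        by (auto simp: coeff_eq_0)
    qed
  qed auto
  finally show ?thesis
    using assms degree_mult_le[of g h] by (simp add: top_coeff_def)
qed

lemma top_coeff_power: "top_coeff d g c \<Longrightarrow> top_coeff (m * d) (g ^ m) (c ^ m)"
  by (induction m) (simp_all add: top_coeff_mult, simp add: top_coeff_def)

lemma top_coeff_prod:
  "finite X \<Longrightarrow> (\<And>i. i \<in> X \<Longrightarrow> top_coeff d (f i) (c i)) \<Longrightarrow>
    top_coeff (card X * d) (prod f X) (prod c X)"
  by (induction X rule: finite_induct) (simp_all add: top_coeff_mult, simp add: top_coeff_def)

lemma top_coeff_sum:
  "finite X \<Longrightarrow> (\<And>i. i \<in> X \<Longrightarrow> top_coeff d (f i) (c i)) \<Longrightarrow> top_coeff d (sum f X) (sum c X)"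
  by (simp add: top_coeff_def degree_sum_le coeff_sum)

lemma top_coeff_const: "top_coeff 0 [:c:] c"
  by (simp add: top_coeff_def)

lemma top_coeff_det:
  fixes A :: "'a::comm_ring_1 poly ^ 'n ^ 'n"
  assumes "\<And>i j. top_coeff 1 (A $ i $ j) (M $ i $ j)"
  shows "top_coeff CARD('n) (det A) (det M)"
  unfolding det_def
proof (rule top_coeff_sum)
  fix \<pi> :: "'n \<Rightarrow> 'n"
  have "top_coeff (0 + CARD('n) * 1) (of_int (sign \<pi>) * (\<Prod>i\<in>UNIV. A $ i $ \<pi> i))
      (of_int (sign \<pi>) * (\<Prod>i\<in>UNIV. M $ i $ \<pi> i))"
    using assms by (intro top_coeff_mult top_coeff_prod)
      (simp_all add: top_coeff_const of_int_poly)
  then show "top_coeff CARD('n) (of_int (sign \<pi>) * (\<Prod>i\<in>UNIV. A $ i $ \<pi> i))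
      (of_int (sign \<pi>) * (\<Prod>i\<in>UNIV. M $ i $ \<pi> i))"
    by simp
qed (simp add: finite_permutations)

text \<open>The rows of \<open>1 + tM\<close> replace those of the identity one at a time.  All intermediate determinants
  have constant term \<open>1\<close> in \<open>t\<close> and can therefore be cancelled; comparing the coefficients of the
  highest power of \<open>t\<close> yields the claim for \<open>M\<close>.\<close>

lemma top_power_det:
  fixes M :: "'a::comm_ring_1 ^ 'n ^ 'n"
  assumes I: "is_ideal I" and char: "prime CHAR('a)"
    and u: "\<And>j. (u $ j) ^ CHAR('a) \<in> I"
  defines "m \<equiv> CHAR('a) - 1"
  shows "(\<Prod>i\<in>UNIV. ((M *v u) $ i) ^ m) - det M ^ m * (\<Prod>j\<in>UNIV. (u $ j) ^ m) \<in> I"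
proof -
  \<comment> \<open>The extension of \<open>I\<close> to the polynomial ring in
    \<open>t\<close>.\<close>
  define J where "J = {g. \<forall>k. coeff g k \<in> I}"
  have J: "is_ideal J"
    unfolding J_def by (rule is_ideal_coeffs[OF I])
  define u' where "u' = (\<chi> j. [:u $ j:])"
  define \<delta> :: "'n \<Rightarrow> 'n \<Rightarrow> 'a" where "\<delta> = (\<lambda>i j. if i = j then 1 else 0)"
  define A where "A = (\<lambda>K. \<chi> i j. [:\<delta> i j, if i \<in> K then M $ i $ j else 0:])"
  define U where "U = (\<Prod>j\<in>UNIV. (u' $ j) ^ m)"
  have m: "Suc m = CHAR('a)"
    using prime_gt_0_nat[OF char] by (simp add: m_def)
  have u'_power: "(u' $ j) ^ Suc m \<in> J" for j
    unfolding m using u[of j] ideal_zero[OF I]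
    by (auto simp: J_def u'_def poly_const_pow coeff_pCons split: nat.split)
  \<comment> \<open>\<open>Suc m\<close> is the characteristic, so this power is additive on the
    terms of the linear form.\<close>
  have expand: "((B *v u') $ i) ^ Suc m = (\<Sum>j\<in>UNIV. (B $ i $ j) ^ Suc m * (u' $ j) ^ Suc m)" for B i
    unfolding m matrix_vector_mult_def
    by (simp add: freshmans_dream_sum char power_mult_distrib)
  have nilpotent: "((B *v u') $ i) ^ Suc m \<in> J" for B i
    unfolding expand by (intro ideal_sum ideal_mult_left J u'_power)
  have regular: "g \<in> J" if "det (A K) * g \<in> J" for K g
  proof -
    have "coeff (det (A K)) 0 = poly (det (A K)) 0"
      by (simp add: poly_0_coeff_0)
    also have "\<dots> = det (mat 1 :: 'a ^ 'n ^ 'n)"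
      unfolding poly_det by (rule arg_cong[where f = det]) (simp add: A_def \<delta>_def mat_def vec_eq_iff)
    finally show ?thesis
      using coeffs_ideal_cancel[OF I, of "det (A K)" g] that by (simp add: J_def)
  qed
  have "(\<Prod>i\<in>UNIV. ((A K *v u') $ i) ^ m) - det (A K) ^ m * U \<in> J" for K
    using finite[of K]
  proof (induction K rule: finite_induct)
    case empty
    have "A {} = mat 1"
      by (simp add: A_def \<delta>_def mat_def vec_eq_iff one_pCons)
    then show ?case
      using J by (simp add: U_def ideal_zero)
  next
    case (insert k K)
    define r where "r = A (insert k K) $ k"
    have eq: "A (insert k K) = (\<chi> i. if i = k then r else row i (A K))"
      by (simp add: r_def A_def row_def vec_eq_iff)
    show ?case
      unfolding eq by (rule top_power_replace_row[OF J regular nilpotent insert.IH])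
  qed
  \<comment> \<open>Each of the \<open>CARD('n)\<close> linear forms has degree at most 1 in
    \<open>t\<close> and enters to the power \<open>m\<close>; the entries of \<open>u'\<close> are
    constant in \<open>t\<close>.\<close>
  then have "coeff ((\<Prod>i\<in>UNIV. ((A UNIV *v u') $ i) ^ m) - det (A UNIV) ^ m * U) (CARD('n) * m) \<in> I"
    by (simp add: J_def)
  moreover have "top_coeff (CARD('n) * (m * 1)) (\<Prod>i\<in>UNIV. ((A UNIV *v u') $ i) ^ m)
      (\<Prod>i\<in>UNIV. ((M *v u) $ i) ^ m)"
  proof (intro top_coeff_prod top_coeff_power)
    fix i
    have "top_coeff (1 + 0) (A UNIV $ i $ j * u' $ j) (M $ i $ j * u $ j)" for j
      by (intro top_coeff_mult) (simp_all add: top_coeff_def A_def u'_def)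
    then show "top_coeff 1 ((A UNIV *v u') $ i) ((M *v u) $ i)"
      by (simp add: matrix_vector_mult_def top_coeff_sum)
  qed simp
  moreover have "top_coeff (m * CARD('n) + CARD('n) * (m * 0)) (det (A UNIV) ^ m * U)
      (det M ^ m * (\<Prod>j\<in>UNIV. (u $ j) ^ m))"
    unfolding U_def
    by (intro top_coeff_mult top_coeff_power top_coeff_prod top_coeff_det)
      (simp_all add: A_def u'_def top_coeff_def)
  ultimately show ?thesis
    by (simp add: top_coeff_def mult.commute)
qed

section \<open>Coefficients of multivariate polynomials\<close>

lemma Const_zero [simp]: "Const 0 = 0"
  and Const_one [simp]: "Const 1 = 1"
  and Const_add: "Const (a + b) = Const a + Const b"
  and Const_uminus: "Const (- c) = - Const c"
  and Const_mult: "Const (a * b) = Const a * Const b"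
  for a b c :: "'k::comm_ring_1"
  by (simp_all add: Const_def mult_single single_add single_uminus)

lemma Const_power: "Const (a ^ m) = Const a ^ m"
  for a :: "'k::comm_ring_1"
  by (induction m) (simp_all add: Const_mult)

lemma Var_power: "Var i ^ m = Poly_Mapping.single (Poly_Mapping.single i m) (1::'k::comm_ring_1)"
  by (induction m) (simp_all add: Var_def mult_single flip: single_add)

lemma prod_monomials:
  "(\<Prod>i\<in>X. Poly_Mapping.single (e i) 1) = Poly_Mapping.single (\<Sum>i\<in>X. e i) (1::'k::comm_ring_1)"
  by (induction X rule: infinite_finite_induct) (simp_all add: mult_single)

lemma lookup_monomial_mult:
  fixes f :: "('n, 'k::comm_ring_1) mpoly"
  shows "Poly_Mapping.lookup (Poly_Mapping.single m c * f) (m + k) = c * Poly_Mapping.lookup f k"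
  by (induction f rule: poly_mapping_single_induct)
    (simp_all add: mult_single lookup_single when_def lookup_add algebra_simps)

lemma lookup_Const_mult:
  fixes f :: "('n, 'k::comm_ring_1) mpoly"
  shows "Poly_Mapping.lookup (Const c * f) k = c * Poly_Mapping.lookup f k"
  using lookup_monomial_mult[of 0 c f k] by (simp add: Const_def)

lemma lookup_Var_mult:
  fixes f :: "('n, 'k::comm_ring_1) mpoly"
  shows "Poly_Mapping.lookup (Var i * f) k =
    (if Poly_Mapping.lookup k i = 0 then 0 else Poly_Mapping.lookup f (k - Poly_Mapping.single i 1))"
proof (induction f rule: poly_mapping_single_induct)
  case (single m c)
  have "Poly_Mapping.single i 1 + m = k \<longleftrightarrow>
      Poly_Mapping.lookup k i \<noteq> 0 \<and> m = k - Poly_Mapping.single i 1"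
    by (auto simp: poly_mapping_eq_iff fun_eq_iff lookup_add lookup_minus lookup_single when_def)
  then show ?case
    by (auto simp: Var_def mult_single lookup_single when_def)
qed (simp_all add: lookup_add algebra_simps)

lemma lookup_0_mult:
  fixes f g :: "('n, 'k::comm_ring_1) mpoly"
  shows "Poly_Mapping.lookup (f * g) 0 = Poly_Mapping.lookup f 0 * Poly_Mapping.lookup g 0"
proof (induction f rule: poly_mapping_single_induct)
  case (single m c)
  show ?case
  proof (induction g rule: poly_mapping_single_induct)
    case (single m' d)
    have "m + m' = 0 \<longleftrightarrow> m = 0 \<and> m' = 0"
      by (auto simp: poly_mapping_eq_iff fun_eq_iff lookup_add)
    then show ?case by (auto simp: mult_single lookup_single when_def)
  qed (simp_all add: lookup_add algebra_simps)
qed (simp_all add: lookup_add algebra_simps)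

lemma lookup_0_Const [simp]: "Poly_Mapping.lookup (Const c) 0 = c"
  by (simp add: Const_def)

lemma lookup_0_Var [simp]: "Poly_Mapping.lookup (Var i :: ('n, 'k::comm_ring_1) mpoly) 0 = 0"
  using lookup_Var_mult[of i "1 :: ('n, 'k) mpoly" 0] by simp

lemma lookup_0_power:
  fixes f :: "('n, 'k::comm_ring_1) mpoly"
  shows "Poly_Mapping.lookup (f ^ m) 0 = Poly_Mapping.lookup f 0 ^ m"
  by (induction m) (simp_all add: lookup_0_mult)

lemma lookup_0_det:
  fixes A :: "('m, 'k::comm_ring_1) mpoly ^ 'n ^ 'n"
  shows "Poly_Mapping.lookup (det A) 0 = det (\<chi> i j. Poly_Mapping.lookup (A $ i $ j) 0)"
proof -
  have "Poly_Mapping.lookup (prod f X) 0 = (\<Prod>i\<in>X. Poly_Mapping.lookup (f i) 0)"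
    for X :: "'n set" and f :: "'n \<Rightarrow> ('m, 'k) mpoly"
    by (induction X rule: infinite_finite_induct) (simp_all add: lookup_0_mult)
  then show ?thesis
    by (simp add: det_def lookup_sum lookup_0_mult lookup_of_int)
qed

text \<open>Makes the freshman's dream available in \<open>k[y][u]\<close>, whose coefficient ring
  is itself a polynomial ring.\<close>

lemma CHAR_mpoly: "CHAR(('n, 'k::comm_ring_1) mpoly) = CHAR('k)"
proof -
  have "(of_nat m :: ('n, 'k) mpoly) = Const (of_nat m)" for m
    by (simp add: Const_def)
  moreover have "(Const c :: ('n, 'k) mpoly) = 0 \<longleftrightarrow> c = 0" for c
    by (metis Const_zero lookup_0_Const)
  ultimately show ?thesis
    by (intro CHAR_eqI) (simp_all add: of_nat_eq_0_iff_char_dvd)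
qed

section \<open>The shift by a second set of variables\<close>

text \<open>With \<open>k[y]\<close> as coefficient ring, \<open>shift f\<close> is \<open>f(u + y)\<close>, where \<open>Var i\<close> is the variable
  \<open>u\<^sub>i\<close> and \<open>Const (Var i)\<close> is \<open>y\<^sub>i\<close>.\<close>

definition shift :: "('n::finite, 'k::comm_ring_1) mpoly \<Rightarrow> ('n, ('n, 'k) mpoly) mpoly" where
  "shift f = (\<Sum>m\<in>Poly_Mapping.keys f. Const (Const (Poly_Mapping.lookup f m)) *
     (\<Prod>i\<in>UNIV. (Var i + Const (Var i)) ^ Poly_Mapping.lookup m i))"

lemma shift_add: "shift (f + g) = shift f + shift g"
  unfolding shift_def
  by (rule setsum_keys_plus_distrib) (simp_all add: Const_add algebra_simps)

lemma shift_zero [simp]: "shift 0 = 0"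
  by (simp add: shift_def)

lemma shift_single: "shift (Poly_Mapping.single m c) =
    Const (Const c) * (\<Prod>i\<in>UNIV. (Var i + Const (Var i)) ^ Poly_Mapping.lookup m i)"
  by (simp add: shift_def)

lemma shift_mult: "shift (f * g) = shift f * shift g"
proof (induction f rule: poly_mapping_single_induct)
  case (single m c)
  show ?case
    by (induction g rule: poly_mapping_single_induct)
      (simp_all add: shift_single mult_single shift_add Const_mult lookup_add power_add
        prod.distrib algebra_simps)
qed (simp_all add: shift_add algebra_simps)

lemma shift_Const [simp]: "shift (Const c) = Const (Const c)"
  by (simp add: Const_def[of c] shift_single)

lemma shift_one [simp]: "shift 1 = 1"
  using shift_Const[of 1] by simp

lemma shift_power: "shift (f ^ m) = shift f ^ m"
  by (induction m) (simp_all add: shift_mult)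

lemma shift_Var [simp]:
  "shift (Var i :: ('n::finite, 'k::comm_ring_1) mpoly) = Var i + Const (Var i)"
proof -
  have "(\<Prod>j\<in>UNIV. (Var j + Const (Var j)) ^ Poly_Mapping.lookup (Poly_Mapping.single i 1) j)
      = (\<Prod>j\<in>UNIV. if j = i then Var j + Const (Var j :: ('n, 'k) mpoly) else 1)"
    by (intro prod.cong) (auto simp: lookup_single when_def)
  then show ?thesis
    by (simp add: Var_def[of i, where ?'k = 'k] shift_single)
qed

lemma lookup_0_shift [simp]: "Poly_Mapping.lookup (shift f) 0 = f"
  by (induction f rule: mpoly_induct) (simp_all add: shift_add shift_mult lookup_add lookup_0_mult)

text \<open>The difference vanishes at \<open>u = 0\<close>, and its linear part in \<open>u\<close>
  has the partial derivatives as coefficients. The \<open>h j\<close> are in general not unique;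
  only their constant terms matter later.\<close>

lemma shift_expand:
  fixes f :: "('n::finite, 'k::comm_ring_1) mpoly"
  shows "\<exists>h. shift f - Const f = (\<Sum>j\<in>UNIV. h j * Var j) \<and>
    (\<forall>j. Poly_Mapping.lookup (h j) 0 = pdiff j f)"
proof (induction f rule: mpoly_induct)
  case (Const c)
  show ?case by (intro exI[of _ "\<lambda>j. 0"]) simp
next
  case (Var i)
  show ?case
    by (intro exI[of _ "\<lambda>j. if j = i then 1 else 0"])
      (auto simp: pdiff_Var if_distrib[of "\<lambda>x. x * _"] cong: if_cong)
next
  case (add f g)
  then obtain h h' where
    h: "shift f - Const f = (\<Sum>j\<in>UNIV. h j * Var j)" "\<And>j. Poly_Mapping.lookup (h j) 0 = pdiff j f" and
    h': "shift g - Const g = (\<Sum>j\<in>UNIV. h' j * Var j)" "\<And>j. Poly_Mapping.lookup (h' j) 0 = pdiff j g"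
    by blast
  have "shift (f + g) - Const (f + g) = (shift f - Const f) + (shift g - Const g)"
    by (simp add: shift_add Const_add)
  also have "\<dots> = (\<Sum>j\<in>UNIV. (h j + h' j) * Var j)"
    unfolding h h' by (simp add: sum.distrib algebra_simps)
  finally show ?case
    using h(2) h'(2) by (intro exI[of _ "\<lambda>j. h j + h' j"]) (simp add: lookup_add pdiff_add)
next
  case (mult f g)
  then obtain h h' where
    h: "shift f - Const f = (\<Sum>j\<in>UNIV. h j * Var j)" "\<And>j. Poly_Mapping.lookup (h j) 0 = pdiff j f" and
    h': "shift g - Const g = (\<Sum>j\<in>UNIV. h' j * Var j)" "\<And>j. Poly_Mapping.lookup (h' j) 0 = pdiff j g"
    by blast
  \<comment> \<open>At \<open>u = 0\<close> the factor \<open>shift f\<close> becomes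
    \<open>f\<close>, so the constant terms follow the Leibniz rule.\<close>
  have "shift (f * g) - Const (f * g)
      = shift f * (shift g - Const g) + Const g * (shift f - Const f)"
    by (simp add: shift_mult Const_mult algebra_simps)
  also have "\<dots> = (\<Sum>j\<in>UNIV. (shift f * h' j + Const g * h j) * Var j)"
    unfolding h h' by (simp add: sum.distrib sum_distrib_left algebra_simps)
  finally show ?case
    using h(2) h'(2) by (intro exI[of _ "\<lambda>j. shift f * h' j + Const g * h j"])
      (simp add: lookup_add lookup_0_mult lookup_Const_mult pdiff_mult)
qed

text \<open>The ideal generated by the \<open>p\<close>-th powers of the variables, described by its monomials.\<close>

definition exceeding :: "nat \<Rightarrow> ('n, 'k::comm_ring_1) mpoly set" where
  "exceeding p = {f. \<forall>k. (\<forall>i. Poly_Mapping.lookup k i < p) \<longrightarrow> Poly_Mapping.lookup f k = 0}"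

text \<open>Induction on the multiplier reduces the convolution product to multiplication by a
  constant or by one variable.\<close>

lemma is_ideal_exceeding: "is_ideal (exceeding p :: ('n, 'k::comm_ring_1) mpoly set)"
proof (rule is_idealI)
  fix f g :: "('n, 'k) mpoly"
  assume "g \<in> exceeding p"
  then show "f * g \<in> exceeding p"
  proof (induction f arbitrary: g rule: mpoly_induct)
    case (Const c)
    then show ?case by (simp add: exceeding_def lookup_Const_mult)
  next
    case (Var i)
    then show ?case
      by (auto simp: exceeding_def lookup_Var_mult lookup_minus less_imp_diff_less)
  next
    case (add f f')
    then show ?case by (simp add: exceeding_def distrib_right lookup_add)
  next
    case (mult f f')
    then show ?case by (simp add: mult.assoc)
  qed
qed (simp_all add: exceeding_def lookup_add)

lemma Var_power_exceeding: "Var i ^ p \<in> exceeding p"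
proof -
  have "Poly_Mapping.single i p \<noteq> k" if "\<forall>j. Poly_Mapping.lookup k j < p" for k
    using that by (metis less_irrefl lookup_single_eq)
  then show ?thesis by (simp add: exceeding_def Var_power lookup_single when_def)
qed

text \<open>The exponent of the product of all \<open>Var i ^ m\<close>. For
  \<open>m = p - 1\<close> it is the largest exponent that membership in \<open>exceeding p\<close>
  forces to have coefficient 0.\<close>

definition diag :: "nat \<Rightarrow> 'n::finite \<Rightarrow>\<^sub>0 nat" where
  "diag m = (\<Sum>i\<in>UNIV. Poly_Mapping.single i m)"

lemma lookup_diag [simp]: "Poly_Mapping.lookup (diag m) i = m"
  by (simp add: diag_def lookup_sum lookup_single when_def)

lemma lookup_diag_exceeding:
  "f \<in> exceeding p \<Longrightarrow> p > 0 \<Longrightarrow> Poly_Mapping.lookup f (diag (p - 1)) = 0"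
  by (simp add: exceeding_def)

lemma prod_Var_power: "(\<Prod>i\<in>UNIV. Var i ^ m) = Poly_Mapping.single (diag m) (1 :: 'k::comm_ring_1)"
  by (simp add: Var_power prod_monomials diag_def)

section \<open>The conductor\<close>

lemma lookup_diag_shift_kernel:
  fixes F :: "'n::finite \<Rightarrow> ('n, 'k::field) mpoly"
  assumes p: "CHAR('k) = p" "p > 0"
  shows "Poly_Mapping.lookup (shift a * (\<Prod>i\<in>UNIV. (shift (F i) - Const (F i)) ^ (p - 1)))
    (diag (p - 1)) = jacobian F ^ (p - 1) * a"
proof -
  have prime: "prime p"
    using prime_CHAR_semidom[where ?'a = 'k] p by simp
  have "\<forall>i. \<exists>h. shift (F i) - Const (F i) = (\<Sum>j\<in>UNIV. h j * Var j) \<and>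
      (\<forall>j. Poly_Mapping.lookup (h j) 0 = pdiff j (F i))"
    using shift_expand by blast
  from choice[OF this] obtain h
    where h: "shift (F i) - Const (F i) = (\<Sum>j\<in>UNIV. h i j * Var j)"
      and h0: "Poly_Mapping.lookup (h i j) 0 = pdiff j (F i)" for i j
    by blast
  define H where "H = (\<chi> i j. h i j)"
  define u :: "('n, ('n, 'k) mpoly) mpoly ^ 'n" where "u = (\<chi> j. Var j)"
  define K where "K = (\<Prod>i\<in>UNIV. (shift (F i) - Const (F i)) ^ (p - 1))"
  define D where "D = Poly_Mapping.single (diag (p - 1)) 1 * det H ^ (p - 1)"
  have detH: "Poly_Mapping.lookup (det H) 0 = jacobian F"
    by (simp add: H_def lookup_0_det h0 jacobian_def)
  have "shift (F i) - Const (F i) = (H *v u) $ i" for i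
    by (simp add: h H_def u_def matrix_vector_mult_def)
  then have K: "K = (\<Prod>i\<in>UNIV. ((H *v u) $ i) ^ (p - 1))"
    by (simp add: K_def)
  have "(u $ j) ^ p \<in> exceeding p" for j
    by (simp add: u_def Var_power_exceeding)
  then have "K - det H ^ (p - 1) * (\<Prod>j\<in>UNIV. Var j ^ (p - 1)) \<in> exceeding p"
    using top_power_det[OF is_ideal_exceeding, of u p H] prime p(1)
    by (simp add: K CHAR_mpoly) (simp add: u_def)
  then have "K - D \<in> exceeding p"
    by (simp add: D_def prod_Var_power mult.commute)
  then have "shift a * (K - D) \<in> exceeding p"
    by (rule ideal_mult_left[OF is_ideal_exceeding])
  then have "Poly_Mapping.lookup (shift a * K) (diag (p - 1))
      = Poly_Mapping.lookup (shift a * D) (diag (p - 1))"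
    using lookup_diag_exceeding[of "shift a * (K - D)" p] p
    by (simp add: right_diff_distrib lookup_minus)
  also have "shift a * D = Poly_Mapping.single (diag (p - 1)) 1 * (shift a * det H ^ (p - 1))"
    by (simp add: D_def mult_ac)
  \<comment> \<open>The coefficient at \<open>diag (p - 1)\<close> of that monomial times a cofactor
    is the constant term of the cofactor, where \<open>shift a\<close> becomes \<open>a\<close> and
    \<open>det H\<close> becomes the Jacobian.\<close>
  also have "Poly_Mapping.lookup \<dots> (diag (p - 1)) = jacobian F ^ (p - 1) * a"
    using lookup_monomial_mult[of "diag (p - 1)" 1 "shift a * det H ^ (p - 1)" 0]
    by (simp add: lookup_0_mult lookup_0_power detH mult.commute)
  finally show ?thesis by (simp add: K_def)
qed

lemma exponent_induct [case_names zero add]: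
  fixes m :: "'n \<Rightarrow>\<^sub>0 nat"
  assumes zero: "P 0" and add: "\<And>m i. P m \<Longrightarrow> P (Poly_Mapping.single i 1 + m)"
  shows "P m"
proof -
  have "P a \<Longrightarrow> P (m + a)" for a
  proof (induction m arbitrary: a rule: poly_mapping_single_induct)
    case (single i k)
    then show ?case
    proof (induction k)
      case (Suc k)
      have "Poly_Mapping.single i (Suc k) + a = Poly_Mapping.single i 1 + (Poly_Mapping.single i k + a)"
        by (simp add: add.assoc[symmetric] flip: single_add)
      then show ?case using add Suc by metis
    qed simp
  qed (simp_all add: add.assoc)
  from this[OF zero] show ?thesis by simp
qed

text \<open>Multiplying by \<open>u\<^sub>i + y\<^sub>i\<close> raises the degree in
  \<open>u\<^sub>i\<close> by at most one, and only the summand \<open>u\<^sub>i\<close> contributes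
  to the new top exponent.\<close>

lemma lookup_shift_monomial:
  fixes m :: "'n::finite \<Rightarrow>\<^sub>0 nat"
  defines "f \<equiv> shift (Poly_Mapping.single m (1 :: 'k::comm_ring_1))"
  shows "Poly_Mapping.lookup f m = 1"
    and "Poly_Mapping.lookup m i < Poly_Mapping.lookup k i \<Longrightarrow> Poly_Mapping.lookup f k = 0"
proof -
  let ?f = "\<lambda>m. shift (Poly_Mapping.single m (1 :: 'k))"
  have "Poly_Mapping.lookup (?f m) m = 1 \<and>
    (\<forall>k i. Poly_Mapping.lookup m i < Poly_Mapping.lookup k i \<longrightarrow> Poly_Mapping.lookup (?f m) k = 0)"
  proof (induction m rule: exponent_induct)
    case zero
    show ?case
      by (auto simp: lookup_one when_def)
  next
    case (add m i)
    have "Poly_Mapping.single (Poly_Mapping.single i 1 + m) (1::'k) = Var i * Poly_Mapping.single m 1"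
      by (simp add: Var_def mult_single)
    then have step: "?f (Poly_Mapping.single i 1 + m) = Var i * ?f m + Const (Var i) * ?f m"
      by (simp only: shift_mult shift_Var distrib_right)
    have "Poly_Mapping.lookup (?f m) (k - Poly_Mapping.single i 1) = 0 \<and> Poly_Mapping.lookup (?f m) k = 0"
      if "Poly_Mapping.lookup (Poly_Mapping.single i 1 + m) j < Poly_Mapping.lookup k j" for k j
    proof -
      have "Poly_Mapping.lookup m j < Poly_Mapping.lookup (k - Poly_Mapping.single i 1) j"
        "Poly_Mapping.lookup m j < Poly_Mapping.lookup k j"
        using that by (auto simp: lookup_add lookup_minus)
      then show ?thesis using add by blast
    qed
    moreover have "Poly_Mapping.lookup (?f m) (Poly_Mapping.single i 1 + m) = 0"
    proof -
      have "Poly_Mapping.lookup m i < Poly_Mapping.lookup (Poly_Mapping.single i 1 + m) i"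
        by (simp add: lookup_add)
      then show ?thesis using add by blast
    qed
    ultimately show ?case
      using add unfolding step by (auto simp: lookup_add lookup_Var_mult lookup_Const_mult)
  qed
  then show "Poly_Mapping.lookup f m = 1"
    and "Poly_Mapping.lookup m i < Poly_Mapping.lookup k i \<Longrightarrow> Poly_Mapping.lookup f k = 0"
    unfolding f_def by blast+
qed

lemma subalgebra_Const: "subalgebra B \<Longrightarrow> Const c \<in> B"
  and subalgebra_add: "subalgebra B \<Longrightarrow> f \<in> B \<Longrightarrow> g \<in> B \<Longrightarrow> f + g \<in> B"
  and subalgebra_mult: "subalgebra B \<Longrightarrow> f \<in> B \<Longrightarrow> g \<in> B \<Longrightarrow> f * g \<in> B"
  by (auto simp: subalgebra_def)

lemma subalgebra_diff: "subalgebra B \<Longrightarrow> f \<in> B \<Longrightarrow> g \<in> B \<Longrightarrow> f - g \<in> B"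
  using subalgebra_add[of B f "Const (- 1) * g"] subalgebra_mult[of B "Const (- 1)" g]
    subalgebra_Const[of B "- 1"]
  by (simp add: Const_uminus)

text \<open>A factor \<open>x\<^sub>i\<^sup>p\<close> becomes
  \<open>u\<^sub>i\<^sup>p + y\<^sub>i\<^sup>p\<close>: the first summand cannot reach the exponent
  \<open>diag (p - 1)\<close>, the second is a scalar from \<open>B\<close>. Once all exponents are
  below \<open>p\<close>, the coefficient is 1 for \<open>diag (p - 1)\<close> itself and 0
  otherwise.\<close>

lemma lookup_diag_shift_mem:
  fixes B :: "('n::finite, 'k::field) mpoly set"
  assumes p: "CHAR('k) = p" "p > 0"
    and B: "subalgebra B" and Var_B: "\<And>i. Var i ^ p \<in> B"
  shows "Poly_Mapping.lookup (shift f) (diag (p - 1)) \<in> B"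
proof -
  have prime: "prime p"
    using prime_CHAR_semidom[where ?'a = 'k] p by simp
  have B01: "0 \<in> B" "1 \<in> B"
    using subalgebra_Const[OF B, of 0] subalgebra_Const[OF B, of 1] by simp_all
  have monomial: "Poly_Mapping.lookup (shift (Poly_Mapping.single m 1)) (diag (p - 1)) \<in> B"
    for m :: "'n \<Rightarrow>\<^sub>0 nat"
  proof (induction "\<Sum>i\<in>UNIV. Poly_Mapping.lookup m i" arbitrary: m rule: less_induct)
    case less
    show ?case
    proof (cases "\<exists>i. p \<le> Poly_Mapping.lookup m i")
      case True
      then obtain i where i: "p \<le> Poly_Mapping.lookup m i" by blast
      define m' where "m' = m - Poly_Mapping.single i p"
      have m: "m = Poly_Mapping.single i p + m'"
        using i by (auto simp: m'_def poly_mapping_eq_iff fun_eq_iff lookup_add lookup_minus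
            lookup_single when_def)
      let ?g = "shift (Poly_Mapping.single m' (1 :: 'k))"
      have "(\<Sum>i\<in>UNIV. Poly_Mapping.lookup m' i) < (\<Sum>i\<in>UNIV. Poly_Mapping.lookup m i)"
        unfolding m using p(2) by (simp add: lookup_add sum.distrib lookup_single when_def)
      then have IH: "Poly_Mapping.lookup ?g (diag (p - 1)) \<in> B"
        by (rule less)
      have "Poly_Mapping.single m 1 = Var i ^ p * Poly_Mapping.single m' (1 :: 'k)"
        unfolding m by (simp add: Var_power mult_single)
      then have "shift (Poly_Mapping.single m (1 :: 'k)) = (Var i + Const (Var i)) ^ p * ?g"
        by (simp add: shift_mult shift_power)
      also have "\<dots> = ?g * Var i ^ p + Const (Var i ^ p) * ?g"
        using prime p by (subst freshmans_dream) (simp_all add: CHAR_mpoly Const_power algebra_simps)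
      finally have "Poly_Mapping.lookup (shift (Poly_Mapping.single m (1 :: 'k))) (diag (p - 1))
          = Poly_Mapping.lookup (?g * Var i ^ p) (diag (p - 1))
            + Var i ^ p * Poly_Mapping.lookup ?g (diag (p - 1))"
        by (simp add: lookup_add lookup_Const_mult)
      also have "Poly_Mapping.lookup (?g * Var i ^ p) (diag (p - 1)) = 0"
        by (intro lookup_diag_exceeding ideal_mult_left is_ideal_exceeding Var_power_exceeding p)
      finally show ?thesis
        using IH Var_B B by (simp add: subalgebra_mult)
    next
      case False
      show ?thesis
      proof (cases "m = diag (p - 1)")
        case True
        then show ?thesis using B01 by (simp add: lookup_shift_monomial)
      next
        case False
        then obtain i where "Poly_Mapping.lookup m i \<noteq> p - 1"
          by (auto simp: poly_mapping_eq_iff fun_eq_iff)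
        with \<open>\<nexists>i. p \<le> Poly_Mapping.lookup m i\<close>
        have "Poly_Mapping.lookup m i < Poly_Mapping.lookup (diag (p - 1)) i"
          by (metis Suc_diff_1 lookup_diag not_less not_less_eq_eq p(2) le_less_linear linorder_neqE_nat not_le)
        then show ?thesis using B01 by (simp add: lookup_shift_monomial(2))
      qed
    qed
  qed
  show ?thesis
  proof (induction f rule: poly_mapping_single_induct)
    case (single m c)
    have "Poly_Mapping.single m c = Const c * Poly_Mapping.single m 1"
      by (simp add: Const_def mult_single)
    then show ?case
      using monomial B by (simp add: shift_mult lookup_Const_mult subalgebra_mult subalgebra_Const)
  next
    case (add f g)
    then show ?case using B by (simp add: shift_add lookup_add subalgebra_add)
  qed (simp add: B01)
qed

lemma jacobian_power_mult_mem:
  fixes B :: "('n::finite, 'k::field) mpoly set"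
  assumes p: "CHAR('k) = p" "p > 0"
    and B: "subalgebra B" and Var_B: "\<And>i. Var i ^ p \<in> B" and F: "range F \<subseteq> B"
  shows "jacobian F ^ (p - 1) * a \<in> B"
proof -
  \<comment> \<open>Quantifying over all \<open>b\<close> makes \<open>S\<close> stable under
    multiplication by \<open>shift f - Const f\<close> with \<open>f\<close> in \<open>B\<close>:
    \<open>shift f\<close> is absorbed into \<open>b\<close>, and \<open>Const f\<close> leaves the
    coefficient as a factor from \<open>B\<close>.\<close>
  define S where "S = {g. \<forall>b. Poly_Mapping.lookup (shift b * g) (diag (p - 1)) \<in> B}"
  have one: "1 \<in> S"
    using lookup_diag_shift_mem[OF p B Var_B] by (simp add: S_def)
  have step: "(shift f - Const f) * g \<in> S" if "f \<in> B" "g \<in> S" for f g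
  proof -
    have "Poly_Mapping.lookup (shift b * ((shift f - Const f) * g)) (diag (p - 1))
        = Poly_Mapping.lookup (shift (b * f) * g) (diag (p - 1))
          - f * Poly_Mapping.lookup (shift b * g) (diag (p - 1))" for b
      by (simp add: algebra_simps shift_mult lookup_minus flip: lookup_Const_mult)
    then show ?thesis
      using that B by (simp add: S_def subalgebra_diff subalgebra_mult)
  qed
  have power: "(shift f - Const f) ^ m * g \<in> S" if "f \<in> B" "g \<in> S" for f g m
    using that by (induction m) (simp_all add: mult.assoc step)
  have "(\<Prod>i\<in>X. (shift (F i) - Const (F i)) ^ (p - 1)) \<in> S" for X
    using F by (induction X rule: infinite_finite_induct) (auto simp: one intro: power)
  from this[of UNIV] show ?thesis
    unfolding S_def lookup_diag_shift_kernel[OF p, symmetric] by blast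
qed

section \<open>From Jacobians to a generator of the Jacobian ideal\<close>

lemma subalgebra_adjoin: "subalgebra (adjoin R S)"
  unfolding adjoin_def by (rule hull_in) (force simp: subalgebra_def image_subset_iff)

lemma mem_ideal_gen_singleton: "x \<in> ideal_gen {d} \<longleftrightarrow> d dvd x"
  unfolding ideal_gen_def module.span_singleton[OF module_times]
  by (auto simp: dvd_def mult.commute)

lemma ideal_power_principal_subset: "ideal_power (ideal_gen {d}) m \<subseteq> ideal_gen {d ^ m}"
proof (induction m)
  case 0
  show ?case by (auto simp: mem_ideal_gen_singleton)
next
  case (Suc m)
  then have "a * b \<in> ideal_gen {d ^ Suc m}"
    if "a \<in> ideal_gen {d}" "b \<in> ideal_power (ideal_gen {d}) m" for a b
    using that by (auto simp: mem_ideal_gen_singleton intro!: mult_dvd_mono)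
  then show ?case
    unfolding ideal_power.simps ideal_gen_def
    by (intro module.span_minimal[OF module_times] module.subspace_span[OF module_times]) auto
qed

text \<open>Writing \<open>d = d s\<close> with \<open>s\<close> in the radical of the ideal quotient \<open>(I : d\<^sup>m)\<close> avoids
  cancelling \<open>d\<close>, so that the ring need not be a domain.\<close>

lemma principal_generator_power_mem:
  fixes I :: "'a::comm_ring_1 set"
  assumes I: "is_ideal I" and d: "ideal_gen {d} = ideal_gen G"
    and G: "\<And>g. g \<in> G \<Longrightarrow> g ^ m \<in> I" and "m > 0"
  shows "d ^ m \<in> I"
proof -
  define Q where "Q = {s. \<exists>k. d ^ m * s ^ k \<in> I}"
  have Q_mult: "c * s \<in> Q" if s: "s \<in> Q" for c s
  proof -
    obtain k where "d ^ m * s ^ k \<in> I" using s by (auto simp: Q_def)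
    then have "c ^ k * (d ^ m * s ^ k) \<in> I" by (rule ideal_mult_left[OF I])
    then show ?thesis by (auto simp: Q_def power_mult_distrib mult_ac)
  qed
  have Q_add: "s + t \<in> Q" if s: "s \<in> Q" and t: "t \<in> Q" for s t
  proof -
    obtain k where k: "d ^ m * s ^ k \<in> I" using s by (auto simp: Q_def)
    obtain l where l: "d ^ m * t ^ l \<in> I" using t by (auto simp: Q_def)
    \<comment> \<open>In each binomial term either \<open>s\<close> has exponent at least
      \<open>k\<close> or \<open>t\<close> has exponent greater than \<open>l\<close>.\<close>
    have "d ^ m * (of_nat (k + l choose i) * s ^ i * t ^ (k + l - i)) \<in> I" if "i \<le> k + l" for i
    proof (cases "k \<le> i")
      case True
      then have "s ^ i = s ^ k * s ^ (i - k)" by (simp flip: power_add)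
      then have "d ^ m * (of_nat (k + l choose i) * s ^ i * t ^ (k + l - i))
          = (of_nat (k + l choose i) * s ^ (i - k) * t ^ (k + l - i)) * (d ^ m * s ^ k)"
        by (simp add: mult_ac)
      then show ?thesis using ideal_mult_left[OF I k] by simp
    next
      case False
      then have "t ^ (k + l - i) = t ^ l * t ^ (k - i)"
        by (simp add: add.commute[of k] flip: power_add)
      then have "d ^ m * (of_nat (k + l choose i) * s ^ i * t ^ (k + l - i))
          = (of_nat (k + l choose i) * s ^ i * t ^ (k - i)) * (d ^ m * t ^ l)"
        by (simp add: mult_ac)
      then show ?thesis using ideal_mult_left[OF I l] by simp
    qed
    then have "d ^ m * (s + t) ^ (k + l) \<in> I"
      unfolding binomial_ring sum_distrib_left by (intro ideal_sum I) auto
    then show ?thesis by (auto simp: Q_def)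
  qed
  \<comment> \<open>For a generator \<open>g = d * s\<close> the hypothesis on \<open>g ^ m\<close>
    puts \<open>s\<close> into \<open>Q\<close> with exponent \<open>m\<close>; sums and multiples
    follow since \<open>Q\<close> is an ideal.\<close>
  have "\<exists>s\<in>Q. x = d * s" if "x \<in> ideal_gen G" for x
    using that unfolding ideal_gen_def
  proof (induction rule: module.span_induct_alt[OF module_times, consumes 1, case_names base step])
    case base
    \<comment> \<open>The exponent must be positive here, since \<open>0 ^ 0 = 1\<close>.\<close>
    have "0 \<in> Q"
      using ideal_zero[OF I] by (auto simp: Q_def intro!: exI[of _ 1])
    then show ?case by (rule bexI[rotated]) simp
  next
    case (step c g y)
    then obtain t where t: "t \<in> Q" "y = d * t" by blast
    have "g \<in> ideal_gen G"
      using step(1) unfolding ideal_gen_def by (rule module.span_base[OF module_times])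
    then have "g \<in> ideal_gen {d}" by (simp only: d)
    then obtain s where s: "g = d * s"
      unfolding mem_ideal_gen_singleton ..
    have "d ^ m * s ^ m \<in> I"
      using G[OF step(1)] by (simp add: s power_mult_distrib)
    then have "c * s + t \<in> Q"
      using t(1) by (intro Q_add Q_mult) (auto simp: Q_def)
    then show ?case
      using s t by (intro bexI[of _ "c * s + t"]) (simp_all add: algebra_simps)
  qed
  moreover have "d \<in> ideal_gen G"
    by (simp add: d[symmetric] mem_ideal_gen_singleton)
  ultimately obtain s k where s: "d = d * s" and k: "d ^ m * s ^ k \<in> I"
    unfolding Q_def by blast
  have absorb: "d * s ^ i = d" for i
  proof (induction i)
    case (Suc i)
    have "d * s ^ Suc i = (d * s) * s ^ i" by (simp add: mult_ac)
    also have "\<dots> = d" using s Suc by metis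
    finally show ?case .
  qed simp
  \<comment> \<open>As \<open>m > 0\<close>, one factor \<open>d\<close> can be split off to absorb
    \<open>s ^ k\<close>.\<close>
  have "d ^ m * s ^ k = (d * s ^ k) * d ^ (m - 1)"
    using \<open>m > 0\<close> by (cases m) (simp_all add: mult_ac)
  also have "\<dots> = d ^ m"
    using \<open>m > 0\<close> unfolding absorb by (cases m) simp_all
  finally have "d ^ m * s ^ k = d ^ m" .
  with k show ?thesis by simp
qed

theorem mainTheorem1:
  fixes R :: "('n::finite, 'k::field) mpoly set" and p :: nat
  assumes "CHAR('k) = p" and "p > 0"
    and "subalgebra R"
    and "principal_ideal (jacobian_ideal R)"
  shows "ideal_power (jacobian_ideal R) ((p ^ CARD('n) * (p - 1)) div 2)
           \<subseteq> adjoin R (range (\<lambda>i. Var i ^ p))"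
proof -
  define B where "B = adjoin R (range (\<lambda>i. Var i ^ p))"
  define q where "q = (p ^ CARD('n) * (p - 1)) div 2"
  have "prime p"
    using prime_CHAR_semidom[where ?'a = 'k] assms(1,2) by simp
  then have p: "p \<ge> 2"
    by (rule prime_ge_2_nat)
  have B: "subalgebra B"
    by (simp add: B_def subalgebra_adjoin)
  have "R \<union> range (\<lambda>i. Var i ^ p) \<subseteq> B"
    unfolding B_def adjoin_def by (rule hull_subset)
  then have RB: "R \<subseteq> B" and Var_B: "Var i ^ p \<in> B" for i
    by auto
  \<comment> \<open>The largest ideal of the polynomial ring contained in \<open>B\<close>.\<close>
  define conductor where "conductor = {c. \<forall>a. c * a \<in> B}"
  have conductor: "is_ideal conductor"
  proof (rule is_idealI)
    show "0 \<in> conductor"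
      using subalgebra_Const[OF B, of 0] by (simp add: conductor_def)
    show "c + c' \<in> conductor" if "c \<in> conductor" "c' \<in> conductor" for c c'
      using that subalgebra_add[OF B] by (simp add: conductor_def distrib_right)
    show "c' * c \<in> conductor" if "c \<in> conductor" for c c'
      using that by (simp add: conductor_def mult.assoc mult.left_commute[of c'])
  qed
  obtain d where d: "jacobian_ideal R = ideal_gen {d}"
    using assms(4) by (auto simp: principal_ideal_def)
  have "d ^ (p - 1) \<in> conductor"
  proof (rule principal_generator_power_mem[OF conductor])
    show "ideal_gen {d} = ideal_gen {jacobian F | F. range F \<subseteq> R}"
      using jacobian_ideal_eq[OF assms(3)] d by simp
    show "g ^ (p - 1) \<in> conductor" if "g \<in> {jacobian F | F. range F \<subseteq> R}" for g
      using that jacobian_power_mult_mem[OF assms(1,2) B Var_B] RB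
      by (auto simp: conductor_def)
    show "p - 1 > 0" using p by simp
  qed
  \<comment> \<open>Comparing the numerator with \<open>2 * (p - 1)\<close> before halving avoids
    any parity question.\<close>
  moreover have "p - 1 \<le> q"
  proof -
    have "2 \<le> p ^ CARD('n)"
      using p self_le_power[of p "CARD('n)"] by simp
    then have "2 * (p - 1) div 2 \<le> q"
      unfolding q_def by (intro div_le_mono mult_right_mono) simp_all
    then show ?thesis by simp
  qed
  then have "d ^ q = d ^ (q - (p - 1)) * d ^ (p - 1)"
    by (simp flip: power_add)
  ultimately have "d ^ q \<in> conductor"
    using ideal_mult_left[OF conductor] by simp
  then have "ideal_gen {d ^ q} \<subseteq> B"
    using ideal_mult_right[OF conductor] by (force simp: mem_ideal_gen_singleton conductor_def dvd_def)
  then show ?thesis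
    using ideal_power_principal_subset[of d q] by (simp add: d q_def B_def)
qed

end
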